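(* Let $K\ge1$ be an integer, $\varepsilon>0$ and $\beta>\log K$. Let $X$ be a rooted tree such that each vertex has at least one and at most $K$ children, equipped with the metric $d_X(x,y)=\int_{[x,y]}e^{-\varepsilon|z|}\,d|z|$ and the measure $d\mu(x)=e^{-\beta|x|}\,d|x|$. Then $\mu$ is doubling, i.e. there is a constant $C$ such that $\mu(B(x,2r))\le C\mu(B(x,r))$ for all $x\in X$ and $r>0$.
   Context: A rooted tree $X$ is a connected graph without cycles with a distinguished vertex $0$ (the root). The neighbor of a vertex closer to the root is its parent, all other neighbors are its children. Each edge is regarded as an isometric copy of the unit interval, so that $X$ consists of vertices and edge points; $[x,y]$ is the geodesic between $x$ and $y$, $|x|$ is the unweighted distance from $0$ to $x$, and $d|z|$ is the measure giving each edge Lebesgue measure $1$. $B(x,r)=\{y\in X:d_X(x,y)<r\}$. *)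

theory Defs
  imports "HOL-Analysis.Analysis"
begin

(* Points of the metric graph.  Edge_Point u v t lies in the interior of the edge from u to
   its child v, at distance t from u (0 < t < 1). *)
datatype 'v point = Vertex 'v | Edge_Point 'v 'v real

(* The isometric copy of [0,1] carried by an edge, running from u (t = 0) to v (t = 1). *)
fun on_edge :: "'v \<times> 'v \<Rightarrow> real \<Rightarrow> 'v point" where
  "on_edge (u, v) t =
     (if t = 0 then Vertex u else if t = 1 then Vertex v else Edge_Point u v t)"

locale rooted_graph =
  fixes V :: "'v set" and E :: "('v \<times> 'v) set" and root :: 'v
begin

definition graph_dist :: "'v \<Rightarrow> 'v \<Rightarrow> nat" where
  "graph_dist u v = (LEAST n. (u, v) \<in> E ^^ n)"

definition is_parent :: "'v \<Rightarrow> 'v \<Rightarrow> bool" where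
  "is_parent p v \<longleftrightarrow> (v, p) \<in> E \<and> graph_dist root p < graph_dist root v"

definition children :: "'v \<Rightarrow> 'v set" where
  "children v = {w. (v, w) \<in> E \<and> \<not> is_parent w v}"

(* Every edge exactly once, directed away from the root. *)
definition edges :: "('v \<times> 'v) set" where
  "edges = {(u, v). u \<in> V \<and> v \<in> children u}"

definition points :: "'v point set" where
  "points = Vertex ` V \<union> {Edge_Point u v t | u v t. (u, v) \<in> edges \<and> 0 < t \<and> t < 1}"

(* chain x y l: one can get from x to y by finitely many moves, each inside a single closed
   edge, of total unweighted length l.  The unweighted distance is the infimum of l. *)
inductive chain :: "'v point \<Rightarrow> 'v point \<Rightarrow> real \<Rightarrow> bool" where
  chain_refl: "x \<in> points \<Longrightarrow> chain x x 0"
| chain_step: "chain x (on_edge e s) l \<Longrightarrow> e \<in> edges \<Longrightarrow> s \<in> {0..1} \<Longrightarrow> t \<in> {0..1} \<Longrightarrow>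
    chain x (on_edge e t) (l + \<bar>s - t\<bar>)"

definition unw_dist :: "'v point \<Rightarrow> 'v point \<Rightarrow> real" where
  "unw_dist x y = Inf {l. chain x y l}"

definition height :: "'v point \<Rightarrow> real" where
  "height x = unw_dist (Vertex root) x"

definition is_geodesic :: "(real \<Rightarrow> 'v point) \<Rightarrow> 'v point \<Rightarrow> 'v point \<Rightarrow> bool" where
  "is_geodesic g x y \<longleftrightarrow>
     g ` {0..unw_dist x y} \<subseteq> points \<and> g 0 = x \<and> g (unw_dist x y) = y \<and>
     (\<forall>s\<in>{0..unw_dist x y}. \<forall>t\<in>{0..unw_dist x y}. unw_dist (g s) (g t) = \<bar>s - t\<bar>)"

(* The set [x,y]; in a tree there is exactly one geodesic from x to y up to the irrelevant
   values of g outside {0..unw_dist x y}, so the union over g is its trace. *)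
definition segment :: "'v point \<Rightarrow> 'v point \<Rightarrow> 'v point set" where
  "segment x y = \<Union> {g ` {0..unw_dist x y} | g. is_geodesic g x y}"

(* The measure d|z|: Lebesgue measure on each edge, summed over the edges.  A set is measurable
   if its trace on each edge is Borel; if there are countably many edges these are the Borel
   sets of the metric graph. *)
definition edge_trace :: "'v \<times> 'v \<Rightarrow> 'v point set \<Rightarrow> real set" where
  "edge_trace e A = {t \<in> {0..1}. on_edge e t \<in> A}"

definition length_measure :: "'v point measure" where
  "length_measure = measure_of points
     {A. A \<subseteq> points \<and> (\<forall>e\<in>edges. edge_trace e A \<in> sets borel)}
     (\<lambda>A. \<integral>\<^sup>+ e. emeasure lborel (edge_trace e A) \<partial>count_space edges)"

definition tree_dist :: "real \<Rightarrow> 'v point \<Rightarrow> 'v point \<Rightarrow> real" where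
  "tree_dist \<epsilon> x y = (LINT z:segment x y|length_measure. exp (- \<epsilon> * height z))"

definition tree_ball :: "real \<Rightarrow> 'v point \<Rightarrow> real \<Rightarrow> 'v point set" where
  "tree_ball \<epsilon> x r = {y \<in> points. tree_dist \<epsilon> x y < r}"

definition tree_measure :: "real \<Rightarrow> 'v point measure" where
  "tree_measure \<beta> = density length_measure (\<lambda>x. ennreal (exp (- \<beta> * height x)))"

end

locale rooted_tree = rooted_graph V E root
  for V :: "'v set" and E :: "('v \<times> 'v) set" and root :: 'v +
  assumes root_in: "root \<in> V"
    and E_subset: "E \<subseteq> V \<times> V"
    and E_sym: "sym E"
    and E_irrefl: "irrefl E"
    and E_connected: "\<And>u v. u \<in> V \<Longrightarrow> v \<in> V \<Longrightarrow> (u, v) \<in> E\<^sup>*"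
    and E_no_cycle: "\<not> (\<exists>c. 3 \<le> length c \<and> distinct c \<and>
          (\<forall>i<length c. (c ! i, c ! (Suc i mod length c)) \<in> E))"

context rooted_tree
begin

(* measure_of does not degenerate here: the given family is a sigma-algebra, and the given set
   function is countably additive on it. *)

lemma on_edge_in_points: "e \<in> edges \<Longrightarrow> t \<in> {0..1} \<Longrightarrow> on_edge e t \<in> points"
  using E_subset by (cases e) (auto simp: points_def edges_def children_def)

lemma length_sigma_algebra:
  "sigma_algebra points {A. A \<subseteq> points \<and> (\<forall>e\<in>edges. edge_trace e A \<in> sets borel)}"
proof (intro sigma_algebra.intro sigma_algebra_axioms.intro)
  show "algebra points {A. A \<subseteq> points \<and> (\<forall>e\<in>edges. edge_trace e A \<in> sets borel)}"
    unfolding algebra_iff_Un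
  proof (intro conjI ballI)
    fix A assume A: "A \<in> {A. A \<subseteq> points \<and> (\<forall>e\<in>edges. edge_trace e A \<in> sets borel)}"
    have "edge_trace e (points - A) = {0..1} - edge_trace e A" if "e \<in> edges" for e
      using on_edge_in_points[OF that] by (auto simp: edge_trace_def)
    with A show "points - A \<in> {A. A \<subseteq> points \<and> (\<forall>e\<in>edges. edge_trace e A \<in> sets borel)}"
      by auto
  next
    fix A B
    assume "A \<in> {A. A \<subseteq> points \<and> (\<forall>e\<in>edges. edge_trace e A \<in> sets borel)}"
      and "B \<in> {A. A \<subseteq> points \<and> (\<forall>e\<in>edges. edge_trace e A \<in> sets borel)}"
    moreover have "edge_trace e (A \<union> B) = edge_trace e A \<union> edge_trace e B" for e
      by (auto simp: edge_trace_def)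
    ultimately show "A \<union> B \<in> {A. A \<subseteq> points \<and> (\<forall>e\<in>edges. edge_trace e A \<in> sets borel)}"
      by auto
  qed (auto simp: edge_trace_def)
next
  fix A :: "nat \<Rightarrow> 'v point set"
  assume "range A \<subseteq> {A. A \<subseteq> points \<and> (\<forall>e\<in>edges. edge_trace e A \<in> sets borel)}"
  moreover have "edge_trace e (\<Union>i. A i) = (\<Union>i. edge_trace e (A i))" for e
    by (auto simp: edge_trace_def)
  ultimately show "(\<Union>i. A i) \<in> {A. A \<subseteq> points \<and> (\<forall>e\<in>edges. edge_trace e A \<in> sets borel)}"
    by (auto simp: subset_eq)
qed

lemma space_length_measure: "space length_measure = points"
  unfolding length_measure_def by (rule space_measure_of) auto

lemma sets_length_measure:
  "sets length_measure = {A. A \<subseteq> points \<and> (\<forall>e\<in>edges. edge_trace e A \<in> sets borel)}"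
  unfolding length_measure_def
  using sigma_algebra.sets_measure_of_eq[OF length_sigma_algebra] .

lemma emeasure_length_measure:
  assumes "A \<in> sets length_measure"
  shows "emeasure length_measure A =
    (\<integral>\<^sup>+ e. emeasure lborel (edge_trace e A) \<partial>count_space edges)"
proof (rule emeasure_measure_of[OF length_measure_def])
  show "countably_additive (sets length_measure)
      (\<lambda>A. \<integral>\<^sup>+ e. emeasure lborel (edge_trace e A) \<partial>count_space edges)"
  proof (rule countably_additiveI)
    fix A :: "nat \<Rightarrow> 'v point set"
    assume A: "range A \<subseteq> sets length_measure" and dis: "disjoint_family A"
    have "(\<Sum>i. \<integral>\<^sup>+ e. emeasure lborel (edge_trace e (A i)) \<partial>count_space edges) =
        (\<integral>\<^sup>+ e. (\<Sum>i. emeasure lborel (edge_trace e (A i))) \<partial>count_space edges)"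
      by (rule nn_integral_suminf[symmetric]) simp
    also have "\<dots> = (\<integral>\<^sup>+ e. emeasure lborel (edge_trace e (\<Union>i. A i)) \<partial>count_space edges)"
    proof (rule nn_integral_cong)
      fix e assume "e \<in> space (count_space edges)"
      then have "range (\<lambda>i. edge_trace e (A i)) \<subseteq> sets lborel"
        using A by (auto simp: sets_length_measure)
      moreover have "disjoint_family (\<lambda>i. edge_trace e (A i))"
        using dis by (auto simp: disjoint_family_on_def edge_trace_def)
      moreover have "edge_trace e (\<Union>i. A i) = (\<Union>i. edge_trace e (A i))"
        by (auto simp: edge_trace_def)
      ultimately show "(\<Sum>i. emeasure lborel (edge_trace e (A i))) =
          emeasure lborel (edge_trace e (\<Union>i. A i))"
        by (simp add: suminf_emeasure)
    qed
    finally show "(\<Sum>i. \<integral>\<^sup>+ e. emeasure lborel (edge_trace e (A i)) \<partial>count_space edges) =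
        (\<integral>\<^sup>+ e. emeasure lborel (edge_trace e (\<Union>i. A i)) \<partial>count_space edges)" .
  qed
qed (use assms in \<open>auto simp: positive_def edge_trace_def\<close>)

end

end

theory Submission
  imports Defs "HOL-Real_Asymp.Real_Asymp"
begin

text \<open>The tree is handled through its infinite rays: sequences of vertices that start at the root and
  always move to a child.  Since every vertex has a child, every point lies on some ray \<open>w\<close> and is
  there \<open>ray_point w t\<close>, with \<open>t\<close> its height.  Two different rays agree up to some height and share
  no point above it, so two points have a last common ancestor, at a height \<open>c\<close> say; the geodesic between
  them descends to it and climbs again.  Along a ray the length measure is Lebesgue measure in the
  height, which gives \<open>d(x, y) = F(|x|) + F(|y|) - 2 F(c)\<close> with \<open>F(t) = (1 - exp (- \<epsilon> t)) / \<epsilon>\<close>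
  (\<open>tree_dist_ray_point\<close>).  This formula also makes the balls measurable.

  For the upper bound, go from \<open>x\<close> towards the root by the distance \<open>R\<close>, stopping at the root if it
  comes first, and let \<open>h\<close> be the height reached.  By the distance formula every \<open>y\<close> in \<open>B(x, R)\<close>
  lies in the subtree of the point reached and satisfies \<open>F(|y|) < F(h) + 2 R\<close>.  There are at most about
  \<open>K powr (t - h)\<close> points at height \<open>t\<close> in that subtree, so the mass of the ball is at most a
  constant times the integral of \<open>K powr (t - h) * exp (- \<beta> t)\<close> over the admissible heights.  Because
  \<open>\<beta> > ln K\<close> the integrand decays exponentially in \<open>t - h\<close>, and the integral is at most a constant
  times \<open>exp (- \<beta> h) * min 1 (R * exp (\<epsilon> h))\<close> (\<open>emeasure_ball_le\<close>).

  For the lower bound, move in the same way by \<open>R\<close> towards the root, to height \<open>h'\<close>, and follow the ray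
  through \<open>x\<close> outwards from there: the part within distance \<open>R\<close> of the new point stays inside
  \<open>B(x, 2 R)\<close>, and its mass is at least a constant times the same expression, with \<open>h'\<close> for \<open>h\<close>
  (\<open>emeasure_ball_ge\<close>).

  For \<open>B(x, 2 r)\<close> the first bound is used with \<open>R = 2 r\<close>, for \<open>B(x, r)\<close> the second with \<open>R = r / 2\<close>.
  The two heights differ by at most \<open>ln 4 / \<epsilon>\<close>, so the two expressions are comparable, uniformly in
  \<open>x\<close> and \<open>r\<close>.  The minimum treats together the balls that look like short intervals and those that reach out to infinity.\<close>

section \<open>Levels in a rooted tree\<close>

context rooted_tree
begin

abbreviation level :: "'v \<Rightarrow> nat" where
  "level v \<equiv> graph_dist root v"

lemma relpow_level: "v \<in> V \<Longrightarrow> (root, v) \<in> E ^^ level v"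
proof -
  assume "v \<in> V"
  then have "\<exists>n. (root, v) \<in> E ^^ n"
    using E_connected[OF root_in] rtrancl_power by fastforce
  then show ?thesis
    unfolding graph_dist_def by (rule LeastI_ex)
qed

lemma level_le: "(root, v) \<in> E ^^ n \<Longrightarrow> level v \<le> n"
  unfolding graph_dist_def by (rule Least_le)

lemma level_root: "level root = 0"
  using level_le[of root 0] by simp

lemma level_eq_0: "v \<in> V \<Longrightarrow> level v = 0 \<Longrightarrow> v = root"
  using relpow_level[of v] by simp

lemma E_V: "(u, v) \<in> E \<Longrightarrow> u \<in> V \<and> v \<in> V"
  using E_subset by auto

lemma E_commute: "(u, v) \<in> E \<Longrightarrow> (v, u) \<in> E"
  using E_sym by (auto dest: symD)

lemma level_E_le: "(u, v) \<in> E \<Longrightarrow> level v \<le> Suc (level u)"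
  using relpow_level[of u] E_V[of u v] by (intro level_le) auto

lemma ex_parent:
  assumes "v \<in> V" "level v = Suc n"
  shows "\<exists>p. (p, v) \<in> E \<and> level p = n"
proof -
  have "(root, v) \<in> E ^^ Suc n"
    using relpow_level[OF assms(1)] assms(2) by simp
  then obtain p where p: "(root, p) \<in> E ^^ n" "(p, v) \<in> E" by auto
  from p have "level p \<le> n" "level v \<le> Suc (level p)"
    by (auto intro: level_le level_E_le)
  with p assms(2) show ?thesis by auto
qed

text \<open>The path follows parents from both vertices until the two lines meet.  It closes up to a cycle as
  soon as its ends are adjacent or have a common neighbour one level further out; this is how the
  absence of cycles is exploited.\<close>

lemma path_through_lower_levels:
  assumes "u \<in> V" "v \<in> V" "u \<noteq> v" "level u = n" "level v = n"
  shows "\<exists>xs. xs \<noteq> [] \<and> distinct (u # xs @ [v]) \<and>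
           successively (\<lambda>a b. (a, b) \<in> E) (u # xs @ [v]) \<and> (\<forall>x\<in>set xs. level x < n)"
  using assms
proof (induction n arbitrary: u v)
  case 0
  then show ?case using level_eq_0 by metis
next
  case (Suc n)
  obtain p where p: "(p, u) \<in> E" "level p = n" using ex_parent Suc.prems by metis
  obtain q where q: "(q, v) \<in> E" "level q = n" using ex_parent Suc.prems by metis
  have pq: "p \<in> V" "q \<in> V" "(u, p) \<in> E" using p q E_V E_commute by blast+
  show ?case
  proof (cases "p = q")
    case True
    have "successively (\<lambda>a b. (a, b) \<in> E) (u # [p] @ [v])"
      using True pq q by simp
    moreover have "distinct (u # [p] @ [v])" using Suc.prems p by auto
    ultimately show ?thesis using p by (intro exI[of _ "[p]"]) auto
  next
    case False
    with Suc.IH[OF pq(1,2)] p q obtain xs where xs: "distinct (p # xs @ [q])"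
      "successively (\<lambda>a b. (a, b) \<in> E) (p # xs @ [q])" "\<forall>x\<in>set xs. level x < n" by auto
    let ?ys = "p # xs @ [q]"
    have low: "\<forall>x\<in>set ?ys. level x < Suc n" using xs p q by auto
    have "successively (\<lambda>a b. (a, b) \<in> E) (u # ?ys @ [v])"
      using xs pq q by (auto simp: successively_append_iff successively_Cons hd_append)
    moreover have "distinct (u # ?ys @ [v])"
      using xs low Suc.prems by auto
    ultimately show ?thesis using low by (intro exI[of _ ?ys]) auto
  qed
qed

lemma no_closed_path:
  assumes "3 \<le> length c" "distinct c" "successively (\<lambda>a b. (a, b) \<in> E) c" "(last c, hd c) \<in> E"
  shows False
proof -
  have "(c ! i, c ! (Suc i mod length c)) \<in> E" if "i < length c" for i
  proof (cases "Suc i < length c")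
    case True
    then show ?thesis using assms(3) by (auto simp: successively_conv_nth)
  next
    case False
    with that have i: "Suc i = length c" by simp
    have "c \<noteq> []" using assms(1) by auto
    then have "c ! i = last c" "c ! 0 = hd c"
      using arg_cong[OF i, of "\<lambda>k. k - 1"] by (simp_all add: last_conv_nth hd_conv_nth)
    then show ?thesis using assms(4) i by simp
  qed
  then show False using assms E_no_cycle by blast
qed

lemma level_E_neq: "(u, v) \<in> E \<Longrightarrow> level u \<noteq> level v"
proof
  assume uv: "(u, v) \<in> E" and eq: "level u = level v"
  have "u \<noteq> v" using uv E_irrefl by (auto simp: irrefl_def)
  then obtain xs where xs: "xs \<noteq> []" "distinct (u # xs @ [v])"
      "successively (\<lambda>a b. (a, b) \<in> E) (u # xs @ [v])"
    using path_through_lower_levels[OF _ _ _ refl eq[symmetric]] E_V[OF uv] by blast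
  have "3 \<le> length (u # xs @ [v])" using xs(1) by (cases xs) auto
  then show False
    using xs uv E_commute by (intro no_closed_path[of "u # xs @ [v]"]) auto
qed

lemma level_edge: "(u, v) \<in> edges \<Longrightarrow> level v = Suc (level u)"
proof -
  assume "(u, v) \<in> edges"
  then have "(u, v) \<in> E" "\<not> level v < level u"
    by (auto simp: edges_def children_def is_parent_def)
  then show ?thesis using level_E_neq[of u v] level_E_le[of u v] by auto
qed

lemma edgesI: "(u, v) \<in> E \<Longrightarrow> level v = Suc (level u) \<Longrightarrow> (u, v) \<in> edges"
  using E_V by (auto simp: edges_def children_def is_parent_def)

lemma edges_V: "(u, v) \<in> edges \<Longrightarrow> u \<in> V \<and> v \<in> V"
  using E_V by (auto simp: edges_def children_def)

text \<open>Two parents of one vertex would be joined by a path through lower levels, and together with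
  the vertex it forms a cycle.\<close>

lemma parent_unique:
  assumes "(p, v) \<in> edges" "(q, v) \<in> edges"
  shows "p = q"
proof (rule ccontr)
  assume "p \<noteq> q"
  have E: "(p, v) \<in> E" "(q, v) \<in> E" using assms by (auto simp: edges_def children_def)
  have lev: "level v = Suc (level p)" "level q = level p"
    using level_edge[OF assms(1)] level_edge[OF assms(2)] by simp_all
  obtain xs where xs: "xs \<noteq> []" "distinct (p # xs @ [q])"
      "successively (\<lambda>a b. (a, b) \<in> E) (p # xs @ [q])" "\<forall>x\<in>set xs. level x < level p"
    using path_through_lower_levels[OF _ _ \<open>p \<noteq> q\<close> refl lev(2)] E_V[OF E(1)] E_V[OF E(2)]
    by blast
  let ?c = "v # p # xs @ [q]"
  have "distinct ?c" using xs lev by auto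
  moreover have "successively (\<lambda>a b. (a, b) \<in> E) ?c"
    using xs(3) E E_commute by (auto simp: successively_Cons)
  ultimately show False using E by (intro no_closed_path[of ?c]) auto
qed

end

section \<open>Rays and the points on them\<close>

locale leafless_tree = rooted_tree V E root
  for V :: "'v set" and E :: "('v \<times> 'v) set" and root :: 'v +
  assumes children_nonempty: "v \<in> V \<Longrightarrow> children v \<noteq> {}"
begin

definition ray :: "(nat \<Rightarrow> 'v) \<Rightarrow> bool" where
  "ray w \<longleftrightarrow> w 0 = root \<and> (\<forall>n. (w n, w (Suc n)) \<in> edges)"

lemma ray_edge: "ray w \<Longrightarrow> (w n, w (Suc n)) \<in> edges"
  by (simp add: ray_def)

lemma level_ray: "ray w \<Longrightarrow> level (w n) = n"
proof (induction n)
  case 0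
  then show ?case by (simp add: ray_def level_root)
next
  case (Suc n)
  then show ?case using level_edge[OF ray_edge, of w n] by simp
qed

lemma ray_V: "ray w \<Longrightarrow> w n \<in> V"
  using ray_edge[of w n] edges_V by auto

lemma ray_eq_down:
  assumes "ray w" "ray w'" "w n = w' n" "m \<le> n"
  shows "w m = w' m"
  using assms(4,3)
proof (induction rule: dec_induct)
  case (step k)
  then show ?case
    using parent_unique[of "w k" "w (Suc k)" "w' k"] ray_edge[OF assms(1), of k]
      ray_edge[OF assms(2), of k] by auto
qed

lemma infinite_child_path:
  assumes "v \<in> V"
  shows "\<exists>f. f 0 = v \<and> (\<forall>n. (f n, f (Suc n)) \<in> edges)"
proof -
  have "\<exists>f. \<forall>n. (f n \<in> V \<and> (n = 0 \<longrightarrow> f n = v)) \<and> (f n, f (Suc n)) \<in> edges"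
  proof (rule dependent_nat_choice)
    show "\<exists>x. x \<in> V \<and> (0 = (0::nat) \<longrightarrow> x = v)" using assms by auto
  next
    fix x and n :: nat assume "x \<in> V \<and> (n = 0 \<longrightarrow> x = v)"
    then obtain y where "(x, y) \<in> edges"
      using children_nonempty by (auto simp: edges_def)
    then show "\<exists>y. (y \<in> V \<and> (Suc n = 0 \<longrightarrow> y = v)) \<and> (x, y) \<in> edges"
      using edges_V by auto
  qed
  then show ?thesis by auto
qed

text \<open>Prepending parents turns an infinite path of children into a ray from the root.\<close>

lemma ray_extending:
  assumes "level (f 0) = n" "\<forall>m. (f m, f (Suc m)) \<in> edges"
  shows "\<exists>w. ray w \<and> (\<forall>m. w (n + m) = f m)"
  using assms
proof (induction n arbitrary: f)
  case 0
  then have "ray f" using level_eq_0[of "f 0"] edges_V[of "f 0" "f (Suc 0)"] by (auto simp: ray_def)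
  then show ?case by (intro exI[of _ f]) auto
next
  case (Suc n)
  have "f 0 \<in> V" using Suc.prems(2) edges_V[of "f 0" "f (Suc 0)"] by blast
  then obtain p where p: "(p, f 0) \<in> E" "level p = n" using ex_parent Suc.prems by metis
  then have "(p, f 0) \<in> edges" using Suc.prems by (auto intro: edgesI)
  then have "\<forall>m. (case_nat p f m, case_nat p f (Suc m)) \<in> edges"
    using Suc.prems by (auto split: nat.split)
  with Suc.IH[of "case_nat p f"] p obtain w
    where w: "ray w" "\<And>m. w (n + m) = case_nat p f m" by auto
  have "w (Suc n + m) = f m" for m using w(2)[of "Suc m"] by simp
  with w(1) show ?case by blast
qed

lemma ray_through_edge:
  assumes "(u, v) \<in> edges"
  shows "\<exists>w. ray w \<and> w (level u) = u \<and> w (Suc (level u)) = v"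
proof -
  obtain f where f: "f 0 = v" "\<forall>n. (f n, f (Suc n)) \<in> edges"
    using infinite_child_path[of v] edges_V[OF assms] by blast
  have "\<forall>m. (case_nat u f m, case_nat u f (Suc m)) \<in> edges"
    using f assms by (auto split: nat.split)
  then obtain w where w: "ray w" "\<And>m. w (level u + m) = case_nat u f m"
    using ray_extending[of "case_nat u f" "level u"] by auto
  show ?thesis using w(1) w(2)[of 0] w(2)[of 1] f by auto
qed

text \<open>The point at height \<open>t\<close>, in terms of the edge of the ray that covers the heights between the
  integers around \<open>t\<close>; a vertex is the lower end of its edge.\<close>

definition ray_point :: "(nat \<Rightarrow> 'v) \<Rightarrow> real \<Rightarrow> 'v point" where
  "ray_point w t = on_edge (w (nat \<lfloor>t\<rfloor>), w (Suc (nat \<lfloor>t\<rfloor>))) (frac t)"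

lemma ray_point_on_edge:
  assumes "0 \<le> \<tau>" "\<tau> \<le> 1"
  shows "ray_point w (real n + \<tau>) = on_edge (w n, w (Suc n)) \<tau>"
proof (cases "\<tau> = 1")
  case True
  have "frac (real n + 1) = 0" by (simp add: frac_def)
  then show ?thesis using True by (simp add: ray_point_def nat_add_distrib)
next
  case False
  then have "\<lfloor>real n + \<tau>\<rfloor> = int n" using assms by linarith
  then show ?thesis by (simp add: ray_point_def frac_def)
qed

lemma nonneg_real_cases:
  assumes "0 \<le> (t::real)"
  obtains n \<tau> where "t = real n + \<tau>" "0 \<le> \<tau>" "\<tau> < 1"
proof
  show "t = real (nat \<lfloor>t\<rfloor>) + frac t" using assms by (simp add: frac_def)
  show "0 \<le> frac t" "frac t < 1" by (simp_all add: frac_lt_1)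
qed

lemma ray_point_in: "ray w \<Longrightarrow> 0 \<le> t \<Longrightarrow> ray_point w t \<in> points"
  by (auto simp: ray_point_def frac_lt_1 less_imp_le simp del: on_edge.simps
      intro!: on_edge_in_points ray_edge)

lemma on_edge_ray:
  assumes "e \<in> edges"
  shows "\<exists>w. ray w \<and> e = (w (level (fst e)), w (Suc (level (fst e)))) \<and>
    (\<forall>\<tau>\<in>{0..1::real}. on_edge e \<tau> = ray_point w (level (fst e) + \<tau>))"
proof -
  obtain u v where e: "e = (u, v)" by (cases e)
  with assms ray_through_edge obtain w
    where w: "ray w" "w (level u) = u" "w (Suc (level u)) = v" by blast
  show ?thesis
    using w e ray_point_on_edge[of _ w "level u"] by (intro exI[of _ w]) auto
qed

lemma point_on_ray:
  assumes "x \<in> points"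
  shows "\<exists>w t. ray w \<and> 0 \<le> t \<and> x = ray_point w t"
proof -
  have "\<exists>e\<in>edges. \<exists>\<tau>\<in>{0..1}. x = on_edge e \<tau>"
    using assms unfolding points_def
  proof safe
    fix v assume "v \<in> V"
    then obtain c where "(v, c) \<in> edges" using children_nonempty by (auto simp: edges_def)
    then show "\<exists>e\<in>edges. \<exists>\<tau>\<in>{0..1}. Vertex v = on_edge e \<tau>" by (force intro!: bexI[of _ 0])
  next
    fix u v :: 'v and t :: real assume "(u, v) \<in> edges" "0 < t" "t < 1"
    then show "\<exists>e\<in>edges. \<exists>\<tau>\<in>{0..1}. Edge_Point u v t = on_edge e \<tau>"
      by (intro bexI[of _ "(u, v)"] bexI[of _ t]) auto
  qed
  then obtain e \<tau> where e: "e \<in> edges" "\<tau> \<in> {0..1}" "x = on_edge e \<tau>" by blast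
  with on_edge_ray[OF e(1)] show ?thesis by (metis add_nonneg_nonneg atLeastAtMost_iff of_nat_0_le_iff)
qed

text \<open>An interior edge point names both ends of its edge, hence the vertex at the height rounded up;
  by uniqueness of parents that vertex determines the ray at all smaller heights.\<close>

lemma ray_point_eq_iff:
  assumes "ray w" "ray w'" "0 \<le> s"
  shows "ray_point w s = ray_point w' s \<longleftrightarrow> w (nat \<lceil>s\<rceil>) = w' (nat \<lceil>s\<rceil>)"
proof -
  obtain n \<tau> where s: "s = real n + \<tau>" "0 \<le> \<tau>" "\<tau> < 1" using nonneg_real_cases assms(3) by blast
  show ?thesis
  proof (cases "\<tau> = 0")
    case True
    then show ?thesis
      using s ray_point_on_edge[of 0 w n] ray_point_on_edge[of 0 w' n] by simp
  next
    case False
    then have "\<lceil>s\<rceil> = int (Suc n)" using s by linarith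
    then have "nat \<lceil>s\<rceil> = Suc n" by simp
    then show ?thesis using s False ray_eq_down[OF assms(1,2), of "Suc n" n]
      by (auto simp: ray_point_on_edge)
  qed
qed

lemma ray_point_eq_height:
  assumes "ray w" "ray w'" "0 \<le> s" "0 \<le> t" "ray_point w s = ray_point w' t"
  shows "s = t"
proof -
  obtain n \<sigma> where s: "s = real n + \<sigma>" "0 \<le> \<sigma>" "\<sigma> < 1" using nonneg_real_cases assms(3) by blast
  obtain m \<tau> where t: "t = real m + \<tau>" "0 \<le> \<tau>" "\<tau> < 1" using nonneg_real_cases assms(4) by blast
  have "w n = w' m \<and> \<sigma> = \<tau>"
    using assms(5) s t by (auto simp: ray_point_on_edge split: if_splits)
  then show ?thesis using level_ray[OF assms(1)] level_ray[OF assms(2)] s t by metis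
qed

lemma ray_point_eq_down:
  assumes "ray w" "ray w'" "0 \<le> a" "a \<le> s" "ray_point w s = ray_point w' s"
  shows "ray_point w a = ray_point w' a"
proof -
  have "nat \<lceil>a\<rceil> \<le> nat \<lceil>s\<rceil>" using assms(4) by (intro nat_mono ceiling_mono)
  then show ?thesis
    using assms ray_eq_down[OF assms(1,2), of "nat \<lceil>s\<rceil>" "nat \<lceil>a\<rceil>"]
    by (simp add: ray_point_eq_iff)
qed

text \<open>Parents are unique, so rays that have parted never meet again.  The bound \<open>T\<close> makes a real
  number available as the height of separation even when the rays never part.\<close>

lemma rays_separate:
  assumes "ray w" "ray w'" "0 \<le> T"
  shows "\<exists>n\<ge>0. \<forall>a\<in>{0..T}. ray_point w a = ray_point w' a \<longleftrightarrow> a \<le> n"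
proof (cases "w (nat \<lceil>T\<rceil>) = w' (nat \<lceil>T\<rceil>)")
  case True
  then have "ray_point w T = ray_point w' T" using ray_point_eq_iff assms by blast
  then show ?thesis using ray_point_eq_down[OF assms(1,2)] assms(3)
    by (intro exI[of _ T]) auto
next
  case False
  define k where "k = (LEAST k. w k \<noteq> w' k)"
  have k: "w k \<noteq> w' k" unfolding k_def by (rule LeastI[where P="\<lambda>k. w k \<noteq> w' k", OF False])
  have less: "j < k \<Longrightarrow> w j = w' j" for j unfolding k_def using not_less_Least by blast
  have iff: "w j = w' j \<longleftrightarrow> j < k" for j
    using less k ray_eq_down[OF assms(1,2), of j k] by (meson not_less)
  have "k \<noteq> 0" using k assms by (auto simp: ray_def intro: ccontr)
  then have "ray_point w a = ray_point w' a \<longleftrightarrow> a \<le> real (k - 1)" if "0 \<le> a" for a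
    using that by (simp add: ray_point_eq_iff[OF assms(1,2)] iff) linarith
  then show ?thesis by (intro exI[of _ "real (k - 1)"]) auto
qed

section \<open>Unweighted distance and geodesics\<close>

text \<open>The number \<open>c\<close> is the height of the last common ancestor of \<open>ray_point w s\<close> and \<open>ray_point w' t\<close>.\<close>

definition meet_height :: "(nat \<Rightarrow> 'v) \<Rightarrow> (nat \<Rightarrow> 'v) \<Rightarrow> real \<Rightarrow> real \<Rightarrow> real \<Rightarrow> bool" where
  "meet_height w w' s t c \<longleftrightarrow> 0 \<le> c \<and> c \<le> s \<and> c \<le> t \<and>
     (\<forall>a. 0 \<le> a \<and> a \<le> s \<and> a \<le> t \<longrightarrow> (ray_point w a = ray_point w' a \<longleftrightarrow> a \<le> c))"

text \<open>As \<open>t\<close> varies along the ray \<open>w'\<close>, the last common ancestor is given by one separation height; this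
  makes the distance to a fixed point an explicit continuous function on each edge.\<close>

lemma meet_height_along_ray:
  assumes "ray w" "ray w'" "0 \<le> s" "0 \<le> T"
  shows "\<exists>n. \<forall>t\<in>{0..T}. meet_height w w' s t (min s (min t n))"
proof -
  obtain n where n: "n \<ge> 0" "\<forall>a\<in>{0..T}. ray_point w a = ray_point w' a \<longleftrightarrow> a \<le> n"
    using rays_separate[OF assms(1,2,4)] by blast
  then show ?thesis using assms by (intro exI[of _ n]) (auto simp: meet_height_def)
qed

lemma ex_meet_height:
  assumes "ray w" "ray w'" "0 \<le> s" "0 \<le> t"
  shows "\<exists>c. meet_height w w' s t c"
  using meet_height_along_ray[OF assms] assms(4) by fastforce

lemma meet_height_same: "0 \<le> s \<Longrightarrow> 0 \<le> t \<Longrightarrow> meet_height w w s t (min s t)"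
  by (auto simp: meet_height_def)

lemma meet_height_commute: "meet_height w w' s t c \<Longrightarrow> meet_height w' w t s c"
  unfolding meet_height_def by metis

lemma chain_trans: "chain y z k \<Longrightarrow> chain x y l \<Longrightarrow> chain x z (l + k)"
proof (induction arbitrary: l rule: chain.induct)
  case (chain_step y e s k t)
  then have "chain x (on_edge e t) (l + k + \<bar>s - t\<bar>)"
    by (intro chain.chain_step) auto
  then show ?case by (simp add: add.assoc)
qed simp

lemma chain_on_ray_edge:
  assumes "ray w" "n \<le> s" "s \<le> real n + 1" "n \<le> t" "t \<le> real n + 1"
  shows "chain (ray_point w s) (ray_point w t) \<bar>s - t\<bar>"
proof -
  let ?e = "(w n, w (Suc n))"
  have pt: "ray_point w s = on_edge ?e (s - n)" "ray_point w t = on_edge ?e (t - n)"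
    using ray_point_on_edge[of "s - n" w n] ray_point_on_edge[of "t - n" w n] assms by simp_all
  have "chain (on_edge ?e (s - n)) (on_edge ?e (s - n)) 0"
    using assms by (intro chain_refl on_edge_in_points ray_edge) auto
  then have "chain (on_edge ?e (s - n)) (on_edge ?e (t - n)) (0 + \<bar>(s - n) - (t - n)\<bar>)"
    using assms by (intro chain_step ray_edge) auto
  then show ?thesis by (simp only: pt) simp
qed

lemma chain_on_ray:
  assumes "ray w" "0 \<le> s" "0 \<le> t"
  shows "chain (ray_point w s) (ray_point w t) \<bar>s - t\<bar>"
proof -
  have "chain (ray_point w s) (ray_point w t) \<bar>s - t\<bar>"
    if "0 \<le> s" "0 \<le> t" "s \<le> real N" "t \<le> real N" for N s t
    using that
  proof (induction N arbitrary: s t)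
    case 0
    then show ?case using chain_on_ray_edge[OF assms(1), of 0 s t] by simp
  next
    case (Suc N)
    consider "s \<le> N" "t \<le> N" | "s \<le> N" "N \<le> t" | "N \<le> s" "t \<le> N" | "N \<le> s" "N \<le> t" by linarith
    then show ?case
    proof cases
      case 1
      with Suc show ?thesis by simp
    next
      case 2
      with Suc.prems have "chain (ray_point w N) (ray_point w t) \<bar>N - t\<bar>"
        by (intro chain_on_ray_edge[OF assms(1), of N]) auto
      from chain_trans[OF this Suc.IH[of s N]] 2 Suc.prems show ?thesis by simp
    next
      case 3
      with Suc.prems have "chain (ray_point w s) (ray_point w N) \<bar>s - N\<bar>"
        by (intro chain_on_ray_edge[OF assms(1), of N]) auto
      from chain_trans[OF Suc.IH[of N t] this] 3 Suc.prems show ?thesis by simp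
    next
      case 4
      with Suc.prems show ?thesis by (intro chain_on_ray_edge[OF assms(1), of N]) auto
    qed
  qed
  from this[of s t "nat \<lceil>max s t\<rceil>"] assms show ?thesis by linarith
qed

text \<open>A chain may wander, but it cannot be shorter than the descent to some common ancestor of
  its ends followed by the ascent: moving inside one edge changes the height by at most the
  length of the move, and the last common ancestor found so far is lowered only when the chain
  passes below it.\<close>

lemma chain_length_ge:
  assumes "chain x y l"
  shows "\<exists>w s w' t c. ray w \<and> ray w' \<and> 0 \<le> c \<and> c \<le> s \<and> c \<le> t \<and>
    x = ray_point w s \<and> y = ray_point w' t \<and> ray_point w c = ray_point w' c \<and> s + t - 2 * c \<le> l"
  using assms
proof (induction rule: chain.induct)
  case (chain_refl x)
  then obtain w t where w: "ray w" "0 \<le> t" "x = ray_point w t" using point_on_ray by blast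
  then show ?case by (intro exI[of _ w] exI[of _ t]) simp
next
  case (chain_step x e a l b)
  then obtain w s w' t c where IH: "ray w" "ray w'" "0 \<le> c" "c \<le> s" "c \<le> t" "x = ray_point w s"
    "on_edge e a = ray_point w' t" "ray_point w c = ray_point w' c" "s + t - 2 * c \<le> l" by blast
  let ?k = "real (level (fst e))"
  obtain v where v: "ray v" "\<forall>\<tau>\<in>{0..1::real}. on_edge e \<tau> = ray_point v (?k + \<tau>)"
    using on_edge_ray[OF chain_step.hyps(2)] by blast
  have eq: "ray_point w' t = ray_point v (?k + a)" using v(2) IH(7) chain_step.hyps by auto
  have t: "t = ?k + a"
    using ray_point_eq_height[OF IH(2) v(1) _ _ eq] IH chain_step.hyps by simp
  define c' where "c' = min c (?k + b)"
  have c': "0 \<le> c'" "c' \<le> s" "c' \<le> ?k + b" "c' \<le> c"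
    using IH chain_step.hyps by (auto simp: c'_def)
  have "ray_point w' c = ray_point v c"
    using ray_point_eq_down[OF IH(2) v(1) IH(3,5)] eq t by simp
  then have "ray_point w c' = ray_point v c'"
    using ray_point_eq_down[OF IH(1) v(1) c'(1,4)] IH(8) by simp
  moreover have "s + (?k + b) - 2 * c' \<le> l + \<bar>a - b\<bar>"
    using IH t by (auto simp: c'_def min_def abs_if)
  moreover have "on_edge e b = ray_point v (?k + b)" using v(2) chain_step.hyps by auto
  ultimately show ?case using IH(1,6) v(1) c'
    by (intro exI[of _ w] exI[of _ s] exI[of _ v] exI[of _ "?k + b"] exI[of _ c']) auto
qed

lemma unw_dist_ray_point:
  assumes "ray w" "ray w'" "meet_height w w' s t c"
  shows "unw_dist (ray_point w s) (ray_point w' t) = s + t - 2 * c"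
proof -
  have c: "0 \<le> c" "c \<le> s" "c \<le> t" "ray_point w c = ray_point w' c"
    using assms(3) by (auto simp: meet_height_def)
  have "chain (ray_point w s) (ray_point w' t) (\<bar>s - c\<bar> + \<bar>c - t\<bar>)"
    using chain_trans[OF chain_on_ray[OF assms(2), of c t], of "ray_point w s" "\<bar>s - c\<bar>"]
      chain_on_ray[OF assms(1), of s c] c by simp
  then have 1: "chain (ray_point w s) (ray_point w' t) (s + t - 2 * c)"
    using c by (simp add: algebra_simps)
  have 2: "s + t - 2 * c \<le> l" if ch: "chain (ray_point w s) (ray_point w' t) l" for l
  proof -
    obtain v s' v' t' c' where v: "ray v" "ray v'" "0 \<le> c'" "c' \<le> s'" "c' \<le> t'"
      "ray_point w s = ray_point v s'" "ray_point w' t = ray_point v' t'"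
      "ray_point v c' = ray_point v' c'" "s' + t' - 2 * c' \<le> l" using chain_length_ge[OF ch] by blast
    have eq: "s' = s" "t' = t"
      using ray_point_eq_height[OF assms(1) v(1) _ _ v(6)]
        ray_point_eq_height[OF assms(2) v(2) _ _ v(7)] c v by auto
    have "ray_point w c' = ray_point w' c'"
      using ray_point_eq_down[OF assms(1) v(1,3)] ray_point_eq_down[OF assms(2) v(2,3)] v eq by metis
    then have "c' \<le> c" using assms(3) v eq by (auto simp: meet_height_def)
    then show ?thesis using v eq by simp
  qed
  show ?thesis unfolding unw_dist_def
    using 1 2 by (intro cInf_eq_minimum) auto
qed

lemma height_ray_point:
  assumes "ray w" "0 \<le> t"
  shows "height (ray_point w t) = t"
proof -
  have "ray_point w 0 = Vertex root"
    using ray_point_on_edge[of 0 w 0] assms(1) by (simp add: ray_def)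
  then show ?thesis
    using unw_dist_ray_point[OF assms(1,1) meet_height_same[of 0 t]] assms(2)
    by (simp add: height_def)
qed

lemma height_on_edge:
  fixes \<tau> :: real
  assumes "e \<in> edges" "\<tau> \<in> {0..1}"
  shows "height (on_edge e \<tau>) = level (fst e) + \<tau>"
proof -
  obtain w where "ray w" "\<forall>\<tau>\<in>{0..1::real}. on_edge e \<tau> = ray_point w (level (fst e) + \<tau>)"
    using on_edge_ray[OF assms(1)] by blast
  then show ?thesis using assms(2) by (simp add: height_ray_point)
qed

text \<open>Descending to the last common ancestor and climbing again is an isometric path.  Conversely, let
  \<open>p\<close> lie on a geodesic and consider its last common ancestors with the two ends.  The lower one is an
  ancestor of both ends, and additivity of the distances forces it to be the last common ancestor
  of the ends and \<open>p\<close> itself to be an ancestor of one of them.\<close>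

lemma segment_ray_point:
  assumes "ray w" "ray w'" "meet_height w w' s t c"
  shows "segment (ray_point w s) (ray_point w' t) = ray_point w ` {c..s} \<union> ray_point w' ` {c..t}"
    (is "segment ?x ?y = _")
proof
  have c: "0 \<le> c" "c \<le> s" "c \<le> t" "ray_point w c = ray_point w' c"
    and iff: "\<And>a. 0 \<le> a \<Longrightarrow> a \<le> s \<Longrightarrow> a \<le> t \<Longrightarrow> ray_point w a = ray_point w' a \<longleftrightarrow> a \<le> c"
    using assms(3) by (auto simp: meet_height_def)
  let ?D = "s + t - 2 * c"
  have D: "unw_dist ?x ?y = ?D" by (rule unw_dist_ray_point[OF assms])
  show "segment ?x ?y \<subseteq> ray_point w ` {c..s} \<union> ray_point w' ` {c..t}"
  proof
    fix p assume "p \<in> segment ?x ?y"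
    then obtain g r where g: "is_geodesic g ?x ?y" "0 \<le> r" "r \<le> ?D" "p = g r"
      unfolding segment_def D by auto
    have "g ` {0..?D} \<subseteq> points" and g0: "g 0 = ?x" and gD: "g ?D = ?y"
      and gd: "\<And>a b. a \<in> {0..?D} \<Longrightarrow> b \<in> {0..?D} \<Longrightarrow> unw_dist (g a) (g b) = \<bar>a - b\<bar>"
      using g(1) unfolding is_geodesic_def D by auto
    then have "p \<in> points" using g by auto
    then obtain v q where v: "ray v" "0 \<le> q" "p = ray_point v q" using point_on_ray by blast
    obtain c1 where c1: "meet_height w v s q c1" using ex_meet_height[of w v s q] assms c v by auto
    obtain c2 where c2: "meet_height v w' q t c2" using ex_meet_height[of v w' q t] assms c v by auto
    have "unw_dist ?x p + unw_dist p ?y = ?D"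
      using gd[of 0 r] gd[of r ?D] g g0 gD c by simp
    then have q: "q = c1 + c2 - c"
      using unw_dist_ray_point[OF assms(1) v(1) c1] unw_dist_ray_point[OF v(1) assms(2) c2] v(3)
      by simp
    have 1: "0 \<le> c1" "c1 \<le> s" "c1 \<le> q" "ray_point w c1 = ray_point v c1"
      using c1 by (auto simp: meet_height_def)
    have 2: "0 \<le> c2" "c2 \<le> q" "c2 \<le> t" "ray_point v c2 = ray_point w' c2"
      using c2 by (auto simp: meet_height_def)
    show "p \<in> ray_point w ` {c..s} \<union> ray_point w' ` {c..t}"
    proof (cases "c1 \<le> c2")
      case True
      then have "ray_point w c1 = ray_point w' c1"
        using ray_point_eq_down[OF v(1) assms(2) 1(1) True 2(4)] 1 by simp
      then have "c1 \<le> c" using iff[of c1] 1 2 True by simp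
      then have "q = c2" "c \<le> q" using q 1 2 by auto
      then show ?thesis using v 2 by auto
    next
      case False
      then have "ray_point w c2 = ray_point w' c2"
        using ray_point_eq_down[OF assms(1) v(1) 2(1) _ 1(4)] 2 by simp
      then have "c2 \<le> c" using iff[of c2] 1 2 False by simp
      then have "q = c1" "c \<le> q" using q 1 2 by auto
      then have "p = ray_point w c1" "c1 \<in> {c..s}" using v 1 by auto
      then show ?thesis by blast
    qed
  qed
  show "ray_point w ` {c..s} \<union> ray_point w' ` {c..t} \<subseteq> segment ?x ?y"
  proof -
    define g where "g r = (if r \<le> s - c then ray_point w (s - r) else ray_point w' (r - s + 2 * c))" for r
    have down: "g r = ray_point w (s - r)" if "r \<le> s - c" for r using that by (simp add: g_def)
    have up: "g r = ray_point w' (r - s + 2 * c)" if "s - c \<le> r" for r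
      using that c(4) by (cases "r = s - c") (auto simp: g_def)
    have same: "unw_dist (ray_point u a) (ray_point u b) = \<bar>a - b\<bar>" if "ray u" "0 \<le> a" "0 \<le> b" for u a b
      using unw_dist_ray_point[OF that(1,1) meet_height_same[OF that(2,3)]] by (simp add: min_def)
    have across: "unw_dist (ray_point w a) (ray_point w' b) = a + b - 2 * c"
        "unw_dist (ray_point w' b) (ray_point w a) = a + b - 2 * c"
      if "c \<le> a" "a \<le> s" "c \<le> b" "b \<le> t" for a b
    proof -
      have "meet_height w w' a b c"
        unfolding meet_height_def using iff that c(1) by simp
      then have "meet_height w w' a b c" "meet_height w' w b a c"
        by (blast intro: meet_height_commute)+
      then show "unw_dist (ray_point w a) (ray_point w' b) = a + b - 2 * c"
        "unw_dist (ray_point w' b) (ray_point w a) = a + b - 2 * c"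
        using unw_dist_ray_point assms by auto
    qed
    have iso: "unw_dist (g a) (g b) = \<bar>a - b\<bar>" if ab: "a \<in> {0..?D}" "b \<in> {0..?D}" for a b
    proof -
      consider "a \<le> s - c" "b \<le> s - c" | "a \<le> s - c" "s - c \<le> b" | "s - c \<le> a" "b \<le> s - c"
        | "s - c \<le> a" "s - c \<le> b" by linarith
      then show ?thesis
      proof cases
        case 1
        then show ?thesis using down[of a] down[of b] same[OF assms(1), of "s - a" "s - b"] c
          by simp
      next
        case 2
        then show ?thesis using down[of a] up[of b] across(1)[of "s - a" "b - s + 2 * c"] c ab by simp
      next
        case 3
        then show ?thesis using down[of b] up[of a] across(2)[of "s - b" "a - s + 2 * c"] c ab by simp
      next
        case 4
        then show ?thesis
          using up[of a] up[of b] same[OF assms(2), of "a - s + 2 * c" "b - s + 2 * c"] c by simp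
      qed
    qed
    have pts: "g ` {0..?D} \<subseteq> points"
      using assms c by (auto simp: g_def intro!: ray_point_in)
    have "is_geodesic g ?x ?y"
      unfolding is_geodesic_def D using iso pts down[of 0] up[of ?D] c by auto
    then have "g ` {0..?D} \<subseteq> segment ?x ?y" unfolding segment_def D[symmetric] by blast
    moreover have "ray_point w a \<in> g ` {0..?D}" if "a \<in> {c..s}" for a
      using down[of "s - a"] that c by (intro image_eqI[of _ _ "s - a"]) auto
    moreover have "ray_point w' a \<in> g ` {0..?D}" if "a \<in> {c..t}" for a
      using up[of "a + s - 2 * c"] that c by (intro image_eqI[of _ _ "a + s - 2 * c"]) auto
    ultimately show ?thesis by auto
  qed
qed

end

section \<open>Integration along edges and rays\<close>

lemma nn_integral_unit_intervals:
  fixes f :: "real \<Rightarrow> ennreal"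
  assumes [measurable]: "f \<in> borel_measurable borel" and neg: "\<And>t. t < 0 \<Longrightarrow> f t = 0"
  shows "(\<Sum>n. \<integral>\<^sup>+\<tau>\<in>{0..1}. f (real n + \<tau>) \<partial>lborel) = (\<integral>\<^sup>+t. f t \<partial>lborel)"
proof -
  have "(\<integral>\<^sup>+\<tau>\<in>{0..1}. f (real n + \<tau>) \<partial>lborel) = (\<integral>\<^sup>+t. f t * indicator {real n..<real n + 1} t \<partial>lborel)"
    for n
  proof -
    have "(\<integral>\<^sup>+\<tau>\<in>{0..1}. f (real n + \<tau>) \<partial>lborel)
        = (\<integral>\<^sup>+\<tau>. f (real n + 1 * \<tau>) * indicator {real n..<real n + 1} (real n + 1 * \<tau>) \<partial>lborel)"
      using AE_lborel_singleton[of "1::real"]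
      by (intro nn_integral_cong_AE) (auto elim!: eventually_mono split: split_indicator)
    also have "\<dots> = (\<integral>\<^sup>+t. f t * indicator {real n..<real n + 1} t \<partial>lborel)"
      by (subst nn_integral_real_affine[where c = 1 and t = "real n",
            of "\<lambda>t. f t * indicator {real n..<real n + 1} t"]) auto
    finally show ?thesis .
  qed
  then have "(\<Sum>n. \<integral>\<^sup>+\<tau>\<in>{0..1}. f (real n + \<tau>) \<partial>lborel)
      = (\<Sum>n. \<integral>\<^sup>+t. f t * indicator {real n..<real n + 1} t \<partial>lborel)"
    by simp
  also have "\<dots> = (\<integral>\<^sup>+t. (\<Sum>n. f t * indicator {real n..<real n + 1} t) \<partial>lborel)"
    by (rule nn_integral_suminf[symmetric]) measurable
  also have "\<dots> = (\<integral>\<^sup>+t. f t \<partial>lborel)"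
  proof (intro nn_integral_cong)
    fix t :: real
    have "disjoint_family (\<lambda>n. {real n..<real n + 1})"
      by (auto simp: disjoint_family_on_def)
    moreover have "t \<in> {real (nat \<lfloor>t\<rfloor>)..<real (nat \<lfloor>t\<rfloor>) + 1}" if "0 \<le> t"
      using that by (simp add: floor_correct)
    ultimately have "(\<Sum>n. f t * indicator {real n..<real n + 1} t) = f t" if "0 \<le> t"
      using that suminf_cmult_indicator[of "\<lambda>n. {real n..<real n + 1}" t _ "\<lambda>_. f t"] by blast
    then show "(\<Sum>n. f t * indicator {real n..<real n + 1} t) = f t"
      using neg[of t] by (cases "t < 0") auto
  qed
  finally show ?thesis .
qed

lemma nn_integral_exp_Icc:
  fixes a b k :: real
  assumes "k \<noteq> 0" "a \<le> b"
  shows "(\<integral>\<^sup>+t\<in>{a..b}. ennreal (exp (- k * t)) \<partial>lborel) = ennreal ((exp (- k * a) - exp (- k * b)) / k)"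
proof -
  have "((\<lambda>t. - exp (- k * t) / k) has_real_derivative exp (- k * x)) (at x)" for x
    using assms(1) by (auto intro!: derivative_eq_intros)
  then have "(\<integral>\<^sup>+t\<in>{a..b}. ennreal (exp (- k * t)) \<partial>lborel)
      = ennreal ((- exp (- k * b) / k) - (- exp (- k * a) / k))"
    using assms(2) by (intro nn_integral_FTC_Icc) (auto simp: has_real_derivative_iff_has_vector_derivative)
  then show ?thesis by (simp add: diff_divide_distrib)
qed

text \<open>The distance from the root to any point of height \<open>t\<close>, for the metric weighted by
  \<open>exp (- \<epsilon> * height z)\<close>.\<close>

definition root_dist :: "real \<Rightarrow> real \<Rightarrow> real" where
  "root_dist \<epsilon> t = (1 - exp (- \<epsilon> * t)) / \<epsilon>"

context leafless_tree
begin

lemma measurable_on_edge: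
  assumes "e \<in> edges"
  shows "on_edge e \<in> restrict_space lborel {0..1} \<rightarrow>\<^sub>M length_measure"
proof (rule measurableI)
  fix \<tau> assume "\<tau> \<in> space (restrict_space lborel {0..1::real})"
  then show "on_edge e \<tau> \<in> space length_measure"
    using on_edge_in_points[OF assms] by (simp add: space_length_measure space_restrict_space)
next
  fix A assume A: "A \<in> sets length_measure"
  have "on_edge e -` A \<inter> space (restrict_space lborel {0..1}) = edge_trace e A"
    by (auto simp: edge_trace_def space_restrict_space)
  then show "on_edge e -` A \<inter> space (restrict_space lborel {0..1})
      \<in> sets (restrict_space lborel {0..1})"
    using A assms by (auto simp: sets_length_measure sets_restrict_space_iff edge_trace_def)
qed

text \<open>The formula is the definition of the measure for indicator functions, and passes to all
  nonnegative measurable functions by linearity and monotone convergence.\<close>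

lemma nn_integral_length_measure:
  assumes "f \<in> borel_measurable length_measure"
  shows "(\<integral>\<^sup>+z. f z \<partial>length_measure)
    = (\<integral>\<^sup>+e. (\<integral>\<^sup>+\<tau>\<in>{0..1}. f (on_edge e \<tau>) \<partial>lborel) \<partial>count_space edges)"
proof -
  (* the contribution of a single edge, as a measure on the points of the tree *)
  define N where "N e = distr (restrict_space lborel {0..1}) length_measure (on_edge e)" for e :: "'v \<times> 'v"
  have [simp]: "sets (N e) = sets length_measure" "space (N e) = space length_measure" for e
    by (simp_all add: N_def)
  have [simp]: "h \<in> borel_measurable (N e) \<longleftrightarrow> h \<in> borel_measurable length_measure"
    for h :: "'v point \<Rightarrow> ennreal" and e
    by (intro arg_cong2[where f="(\<in>)"] measurable_cong_sets) auto
  have em: "emeasure (N e) A = emeasure lborel (edge_trace e A)"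
    if "e \<in> edges" "A \<in> sets length_measure" for e A
  proof -
    have "on_edge e -` A \<inter> space (restrict_space lborel {0..1}) = edge_trace e A"
      by (auto simp: edge_trace_def space_restrict_space)
    then have "emeasure (N e) A = emeasure (restrict_space lborel {0..1}) (edge_trace e A)"
      using that measurable_on_edge by (simp add: N_def emeasure_distr)
    also have "\<dots> = emeasure lborel (edge_trace e A)"
      by (rule emeasure_restrict_space) (auto simp: edge_trace_def)
    finally show ?thesis .
  qed
  have "(\<integral>\<^sup>+z. f z \<partial>length_measure) = (\<integral>\<^sup>+e. (\<integral>\<^sup>+z. f z \<partial>N e) \<partial>count_space edges)"
    using assms
  proof (induction rule: borel_measurable_induct)
    case (cong f g)
    have "(\<integral>\<^sup>+z. f z \<partial>length_measure) = (\<integral>\<^sup>+z. g z \<partial>length_measure)"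
      "\<And>e. (\<integral>\<^sup>+z. f z \<partial>N e) = (\<integral>\<^sup>+z. g z \<partial>N e)"
      using cong(3) by (auto intro: nn_integral_cong)
    then show ?case using cong(4) by simp
  next
    case (set A)
    then show ?case
      by (auto simp: emeasure_length_measure em intro!: nn_integral_cong)
  next
    case (mult u c)
    then show ?case by (simp add: nn_integral_cmult)
  next
    case (add u v)
    then show ?case by (simp add: nn_integral_add)
  next
    case (seq U)
    have "(\<integral>\<^sup>+z. (SUP i. U i z) \<partial>length_measure) = (SUP i. \<integral>\<^sup>+z. U i z \<partial>length_measure)"
      using seq by (intro nn_integral_monotone_convergence_SUP) auto
    also have "\<dots> = (SUP i. \<integral>\<^sup>+e. (\<integral>\<^sup>+z. U i z \<partial>N e) \<partial>count_space edges)"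
      using seq by simp
    also have "\<dots> = (\<integral>\<^sup>+e. (SUP i. \<integral>\<^sup>+z. U i z \<partial>N e) \<partial>count_space edges)"
      using seq by (intro nn_integral_monotone_convergence_SUP[symmetric])
        (auto simp: incseq_def le_fun_def intro!: nn_integral_mono)
    also have "\<dots> = (\<integral>\<^sup>+e. (\<integral>\<^sup>+z. (SUP i. U i z) \<partial>N e) \<partial>count_space edges)"
      using seq by (intro nn_integral_cong nn_integral_monotone_convergence_SUP[symmetric]) auto
    finally show ?case by (simp add: image_comp)
  qed
  also have "\<dots> = (\<integral>\<^sup>+e. (\<integral>\<^sup>+\<tau>\<in>{0..1}. f (on_edge e \<tau>) \<partial>lborel) \<partial>count_space edges)"
    using assms
    by (intro nn_integral_cong)
      (simp add: N_def nn_integral_distr measurable_on_edge nn_integral_restrict_space)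
  finally show ?thesis .
qed

lemma borel_measurable_height [measurable]: "height \<in> borel_measurable length_measure"
proof (rule measurableI)
  fix S :: "real set" assume S: "S \<in> sets borel"
  have "edge_trace e (height -` S \<inter> points) \<in> sets borel" if e: "e \<in> edges" for e
  proof -
    have "edge_trace e (height -` S \<inter> points) = {0..1} \<inter> {\<tau>. real (level (fst e)) + \<tau> \<in> S}"
      using height_on_edge[OF e] on_edge_in_points[OF e] by (auto simp: edge_trace_def)
    moreover have "{\<tau>. real (level (fst e)) + \<tau> \<in> S} \<in> sets borel" using S by measurable
    ultimately show ?thesis by auto
  qed
  then show "height -` S \<inter> space length_measure \<in> sets length_measure"
    by (auto simp: sets_length_measure space_length_measure)
qed simp

lemma edge_trace_ray:
  assumes "ray w" "B \<subseteq> {0..}"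
  shows "edge_trace (w n, w (Suc n)) (ray_point w ` B) = {0..1} \<inter> {\<tau>. real n + \<tau> \<in> B}"
proof -
  have "on_edge (w n, w (Suc n)) \<tau> \<in> ray_point w ` B \<longleftrightarrow> real n + \<tau> \<in> B" if "\<tau> \<in> {0..1}" for \<tau>
    using ray_point_eq_height[OF assms(1,1), of "real n + \<tau>"] that assms(2)
      ray_point_on_edge[of \<tau> w n, symmetric] by (auto simp del: on_edge.simps)
  then show ?thesis by (auto simp: edge_trace_def simp del: on_edge.simps)
qed

lemma edge_trace_off_ray:
  assumes "ray w" "B \<subseteq> {0..}" "e \<notin> range (\<lambda>n. (w n, w (Suc n)))"
  shows "edge_trace e (ray_point w ` B) \<subseteq> {0, 1}"
proof
  fix \<tau> assume \<tau>: "\<tau> \<in> edge_trace e (ray_point w ` B)"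
  then obtain t where t: "0 \<le> t" "on_edge e \<tau> = ray_point w t" "\<tau> \<in> {0..1}"
    using assms(2) by (auto simp: edge_trace_def simp del: on_edge.simps)
  obtain n \<sigma> where n: "t = real n + \<sigma>" "0 \<le> \<sigma>" "\<sigma> < 1" using nonneg_real_cases t(1) by blast
  have "e \<noteq> (w n, w (Suc n))" using assms(3) by auto
  then show "\<tau> \<in> {0, 1}"
    using t(2,3) n by (cases e) (auto simp: ray_point_on_edge split: if_splits)
qed

lemma ray_image_sets:
  assumes "ray w" "B \<subseteq> {0..}" "B \<in> sets borel"
  shows "ray_point w ` B \<in> sets length_measure"
proof -
  have "edge_trace e (ray_point w ` B) \<in> sets borel" if "e \<in> edges" for e
  proof (cases "e \<in> range (\<lambda>n. (w n, w (Suc n)))")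
    case True
    then obtain n where n: "e = (w n, w (Suc n))" by auto
    have "{\<tau>. real n + \<tau> \<in> B} \<in> sets borel" using assms(3) by measurable
    then show ?thesis using edge_trace_ray[OF assms(1,2), of n] n by auto
  next
    case False
    then have "finite (edge_trace e (ray_point w ` B))"
      using edge_trace_off_ray[OF assms(1,2)] finite_subset by blast
    then show ?thesis by (simp add: borel_closed finite_imp_closed)
  qed
  then show ?thesis using ray_point_in[OF assms(1)] assms(2)
    by (auto simp: sets_length_measure)
qed

text \<open>Height is arc length along a ray, and the edges off the ray meet it only in endpoints.\<close>

lemma nn_integral_ray:
  assumes "ray w" "B \<subseteq> {0..}" "B \<in> sets borel" and [measurable]: "g \<in> borel_measurable borel"
  shows "(\<integral>\<^sup>+z\<in>ray_point w ` B. g (height z) \<partial>length_measure) = (\<integral>\<^sup>+t\<in>B. g t \<partial>lborel)"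
proof -
  let ?R = "ray_point w ` B" and ?e = "\<lambda>n. (w n, w (Suc n))"
  note [measurable] = ray_image_sets[OF assms(1-3)] assms(3)
  define G where "G e = (\<integral>\<^sup>+\<tau>\<in>{0..1}. (g (height (on_edge e \<tau>)) * indicator ?R (on_edge e \<tau>)) \<partial>lborel)"
    for e
  have G: "G (?e n) = (\<integral>\<^sup>+\<tau>\<in>{0..1}. (g (real n + \<tau>) * indicator B (real n + \<tau>)) \<partial>lborel)" for n
    unfolding G_def
  proof (intro nn_integral_cong)
    fix \<tau> :: real
    have "height (on_edge (?e n) \<tau>) = real n + \<tau>" if "\<tau> \<in> {0..1}"
      using height_on_edge[OF ray_edge[OF assms(1)] that, of n] level_ray[OF assms(1), of n] by simp
    moreover have "on_edge (?e n) \<tau> \<in> ?R \<longleftrightarrow> real n + \<tau> \<in> B" if "\<tau> \<in> {0..1}"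
      using edge_trace_ray[OF assms(1,2), of n] that
      by (auto simp: edge_trace_def simp del: on_edge.simps)
    ultimately show "g (height (on_edge (?e n) \<tau>)) * indicator ?R (on_edge (?e n) \<tau>) * indicator {0..1} \<tau>
        = g (real n + \<tau>) * indicator B (real n + \<tau>) * indicator {0..1} \<tau>"
      by (auto split: split_indicator simp del: on_edge.simps)
  qed
  have "(\<integral>\<^sup>+z\<in>?R. g (height z) \<partial>length_measure) = (\<integral>\<^sup>+e. G e \<partial>count_space edges)"
    unfolding G_def by (rule nn_integral_length_measure) measurable
  also have "\<dots> = (\<integral>\<^sup>+e. G e \<partial>count_space (range ?e))"
  proof (rule nn_integral_count_space_eq)
    fix e assume e: "e \<in> edges - range ?e"
    have "AE \<tau> in lborel. g (height (on_edge e \<tau>)) * indicator ?R (on_edge e \<tau>) * indicator {0..1} \<tau> = 0"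
      using AE_lborel_singleton[of "0::real"] AE_lborel_singleton[of "1::real"]
    proof eventually_elim
      case (elim \<tau>)
      then have "\<tau> \<notin> edge_trace e ?R" using edge_trace_off_ray[OF assms(1,2)] e by blast
      then show ?case by (auto simp: edge_trace_def split: split_indicator)
    qed
    then show "G e = 0" unfolding G_def by (subst nn_integral_cong_AE[where v="\<lambda>_. 0"]) auto
  qed (use ray_edge[OF assms(1)] in auto)
  also have "\<dots> = (\<integral>\<^sup>+n. G (?e n) \<partial>count_space UNIV)"
  proof (rule nn_integral_bij_count_space[symmetric])
    have "inj ?e" using level_ray[OF assms(1)] by (metis (no_types, lifting) Pair_inject injI)
    then show "bij_betw ?e UNIV (range ?e)" by (simp add: bij_betw_def)
  qed
  also have "\<dots> = (\<Sum>n. G (?e n))" by (rule nn_integral_count_space_nat)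
  also have "\<dots> = (\<Sum>n. \<integral>\<^sup>+\<tau>\<in>{0..1}. (g (real n + \<tau>) * indicator B (real n + \<tau>)) \<partial>lborel)"
    by (simp only: G)
  also have "(\<Sum>n. \<integral>\<^sup>+\<tau>\<in>{0..1}. (g (real n + \<tau>) * indicator B (real n + \<tau>)) \<partial>lborel)
      = (\<integral>\<^sup>+t\<in>B. g t \<partial>lborel)"
    using assms(2) by (intro nn_integral_unit_intervals) (auto split: split_indicator)
  finally show ?thesis .
qed

section \<open>The weighted metric and its balls\<close>

text \<open>The integral over the geodesic splits at the last common ancestor into two pieces of rays.  The
  ancestor itself is assigned to the first piece to make the pieces disjoint.\<close>

lemma tree_dist_ray_point:
  assumes "\<epsilon> > 0" "ray w" "ray w'" "meet_height w w' s t c"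
  shows "tree_dist \<epsilon> (ray_point w s) (ray_point w' t)
    = root_dist \<epsilon> s + root_dist \<epsilon> t - 2 * root_dist \<epsilon> c"
proof -
  have c: "0 \<le> c" "c \<le> s" "c \<le> t" "ray_point w c = ray_point w' c"
    and iff: "\<And>a. 0 \<le> a \<Longrightarrow> a \<le> s \<Longrightarrow> a \<le> t \<Longrightarrow> ray_point w a = ray_point w' a \<longleftrightarrow> a \<le> c"
    using assms(4) by (auto simp: meet_height_def)
  let ?f = "\<lambda>z. ennreal (exp (- \<epsilon> * height z))"
  let ?A = "ray_point w ` {c..s}" and ?B = "ray_point w' ` {c<..t}"
  have [measurable]: "?A \<in> sets length_measure" "?B \<in> sets length_measure"
    using c by (auto intro!: ray_image_sets assms)
  have "segment (ray_point w s) (ray_point w' t) = ?A \<union> ?B"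
  proof -
    have "{c..t} = insert c {c<..t}" using c by auto
    then have "ray_point w' ` {c..t} = insert (ray_point w c) ?B" using c(4) by simp
    moreover have "ray_point w c \<in> ?A" by (rule imageI) (use c in auto)
    ultimately show ?thesis
      unfolding segment_ray_point[OF assms(2-4)] by (simp only: Un_insert_right insert_absorb Un_iff simp_thms)
  qed
  moreover have "?A \<inter> ?B = {}"
  proof -
    have False if "ray_point w a = ray_point w' b" "a \<in> {c..s}" "b \<in> {c<..t}" for a b
    proof -
      have "a = b" using that(2,3) c(1) by (intro ray_point_eq_height[OF assms(2,3) _ _ that(1)]) auto
      then have "ray_point w b = ray_point w' b" "b \<le> s" using that by simp_all
      then have "b \<le> c" using iff[of b] that(3) c(1) by simp
      then show False using that(3) by simp
    qed
    then show ?thesis by blast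
  qed
  ultimately have ind: "indicator (segment (ray_point w s) (ray_point w' t)) z
      = indicator ?A z + (indicator ?B z :: ennreal)" for z
    by (auto split: split_indicator)
  let ?S = "segment (ray_point w s) (ray_point w' t)"
  have S [measurable]: "?S \<in> sets length_measure"
    using \<open>?S = ?A \<union> ?B\<close> by simp
  have "tree_dist \<epsilon> (ray_point w s) (ray_point w' t)
      = enn2real (\<integral>\<^sup>+z. ennreal (indicator ?S z *\<^sub>R exp (- \<epsilon> * height z)) \<partial>length_measure)"
    unfolding tree_dist_def set_lebesgue_integral_def
    by (rule integral_eq_nn_integral) auto
  also have "(\<integral>\<^sup>+z. ennreal (indicator ?S z *\<^sub>R exp (- \<epsilon> * height z)) \<partial>length_measure)
      = (\<integral>\<^sup>+z. ?f z * indicator ?A z + ?f z * indicator ?B z \<partial>length_measure)"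
  proof (intro nn_integral_cong)
    fix z
    have "ennreal (indicator ?S z *\<^sub>R exp (- \<epsilon> * height z)) = ?f z * indicator ?S z"
      by (auto split: split_indicator)
    then show "ennreal (indicator ?S z *\<^sub>R exp (- \<epsilon> * height z))
        = ?f z * indicator ?A z + ?f z * indicator ?B z"
      by (simp add: ind distrib_left)
  qed
  also have "\<dots> = (\<integral>\<^sup>+z\<in>?A. ?f z \<partial>length_measure) + (\<integral>\<^sup>+z\<in>?B. ?f z \<partial>length_measure)"
    by (intro nn_integral_add) measurable
  also have "(\<integral>\<^sup>+z\<in>?A. ?f z \<partial>length_measure) = (\<integral>\<^sup>+x\<in>{c..s}. ennreal (exp (- \<epsilon> * x)) \<partial>lborel)"
    using c by (intro nn_integral_ray assms) auto
  also have "(\<integral>\<^sup>+z\<in>?B. ?f z \<partial>length_measure) = (\<integral>\<^sup>+x\<in>{c<..t}. ennreal (exp (- \<epsilon> * x)) \<partial>lborel)"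
    using c by (intro nn_integral_ray assms) auto
  also have "\<dots> = (\<integral>\<^sup>+x\<in>{c..t}. ennreal (exp (- \<epsilon> * x)) \<partial>lborel)"
    using AE_lborel_singleton[of c]
    by (intro nn_integral_cong_AE) (auto elim!: eventually_mono split: split_indicator)
  finally have "tree_dist \<epsilon> (ray_point w s) (ray_point w' t) =
      enn2real (ennreal ((exp (- \<epsilon> * c) - exp (- \<epsilon> * s)) / \<epsilon>)
        + ennreal ((exp (- \<epsilon> * c) - exp (- \<epsilon> * t)) / \<epsilon>))"
    using assms(1) c by (simp only: nn_integral_exp_Icc)
  also have "\<dots> = (exp (- \<epsilon> * c) - exp (- \<epsilon> * s)) / \<epsilon> + (exp (- \<epsilon> * c) - exp (- \<epsilon> * t)) / \<epsilon>"
    using assms(1) c by (simp flip: ennreal_plus)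
  finally show ?thesis by (simp add: root_dist_def diff_divide_distrib)
qed

lemma tree_ball_sets:
  assumes "\<epsilon> > 0" "x \<in> points"
  shows "tree_ball \<epsilon> x r \<in> sets length_measure"
proof -
  obtain w s where x: "ray w" "0 \<le> s" "x = ray_point w s" using point_on_ray assms(2) by blast
  have "edge_trace e (tree_ball \<epsilon> x r) \<in> sets borel" if e: "e \<in> edges" for e
  proof -
    let ?k = "real (level (fst e))"
    obtain v where v: "ray v" "\<forall>\<tau>\<in>{0..1::real}. on_edge e \<tau> = ray_point v (?k + \<tau>)"
      using on_edge_ray[OF e] by blast
    obtain n where n: "\<forall>t\<in>{0..?k + 1}. meet_height w v s t (min s (min t n))"
      using meet_height_along_ray[OF x(1) v(1) x(2), of "?k + 1"] by auto
    let ?d = "\<lambda>\<tau>. root_dist \<epsilon> s + root_dist \<epsilon> (?k + \<tau>) - 2 * root_dist \<epsilon> (min s (min (?k + \<tau>) n))"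
    have "tree_dist \<epsilon> x (on_edge e \<tau>) = ?d \<tau>" if "\<tau> \<in> {0..1}" for \<tau>
      using tree_dist_ray_point[OF assms(1) x(1) v(1), of s "?k + \<tau>"] n v(2) that x(3) by auto
    then have "edge_trace e (tree_ball \<epsilon> x r) = {0..1} \<inter> {\<tau>. ?d \<tau> < r}"
      using on_edge_in_points[OF e] by (auto simp: edge_trace_def tree_ball_def)
    moreover have "{\<tau>. ?d \<tau> < r} \<in> sets borel"
      unfolding root_dist_def by measurable
    ultimately show ?thesis by auto
  qed
  then show ?thesis by (auto simp: sets_length_measure tree_ball_def)
qed

end

section \<open>The mass of balls\<close>

lemma root_dist_mono: "0 < \<epsilon> \<Longrightarrow> s \<le> t \<Longrightarrow> root_dist \<epsilon> s \<le> root_dist \<epsilon> t"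
  by (simp add: root_dist_def divide_right_mono)

lemma root_dist_le_iff: "0 < \<epsilon> \<Longrightarrow> root_dist \<epsilon> s \<le> root_dist \<epsilon> t \<longleftrightarrow> s \<le> t"
  by (simp add: root_dist_def divide_le_cancel)

lemma root_dist_nonneg: "0 < \<epsilon> \<Longrightarrow> 0 \<le> t \<Longrightarrow> 0 \<le> root_dist \<epsilon> t"
  by (simp add: root_dist_def)

lemma exp_root_dist: "0 < \<epsilon> \<Longrightarrow> exp (- (\<epsilon> * t)) = 1 - \<epsilon> * root_dist \<epsilon> t"
  by (simp add: root_dist_def)

text \<open>The height reached when moving by the distance \<open>r\<close> towards the root, or the root itself when it
  is closer than that.\<close>

lemma ex_height_towards_root:
  assumes "0 < \<epsilon>" "0 \<le> s" "0 < r"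
  shows "\<exists>h. 0 \<le> h \<and> h \<le> s \<and> root_dist \<epsilon> h = max (root_dist \<epsilon> s - r) 0"
proof -
  define h where "h = - ln (min (exp (- \<epsilon> * s) + \<epsilon> * r) 1) / \<epsilon>"
  have pos: "0 < min (exp (- \<epsilon> * s) + \<epsilon> * r) 1" using assms by (simp add: add_pos_pos)
  have "exp (- \<epsilon> * h) = min (exp (- \<epsilon> * s) + \<epsilon> * r) 1"
    using pos assms(1) by (simp add: h_def)
  also have "\<dots> = 1 - \<epsilon> * max (root_dist \<epsilon> s - r) 0"
  proof -
    let ?d = "root_dist \<epsilon> s - r"
    have "exp (- \<epsilon> * s) + \<epsilon> * r = 1 - \<epsilon> * ?d"
      using assms(1) by (simp add: exp_root_dist algebra_simps)
    moreover have "min (1 - \<epsilon> * ?d) 1 = 1 - \<epsilon> * max ?d 0"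
      using assms(1) by (cases "0 \<le> ?d") (auto simp: min_def max_def mult_less_0_iff zero_le_mult_iff)
    ultimately show ?thesis by simp
  qed
  finally have eq: "root_dist \<epsilon> h = max (root_dist \<epsilon> s - r) 0"
    using assms(1) by (simp add: exp_root_dist)
  have "root_dist \<epsilon> 0 \<le> root_dist \<epsilon> h" using eq by (simp add: root_dist_def)
  moreover have "root_dist \<epsilon> h \<le> root_dist \<epsilon> s"
    using eq assms root_dist_nonneg[OF assms(1,2)] by simp
  ultimately show ?thesis using eq root_dist_le_iff[OF assms(1)] by blast
qed

text \<open>The integrand equals \<open>exp (- \<beta> * h) * exp (- (\<beta> - k) * (t - h))\<close>.  Put
  \<open>\<kappa> = \<epsilon> * \<sigma> * exp (\<epsilon> * h)\<close>, so that the condition on the root distance reads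
  \<open>1 - exp (- \<epsilon> * (t - h)) < \<kappa>\<close>.  For small \<open>\<kappa>\<close> it confines \<open>t - h\<close> to an interval of length of order
  \<open>\<kappa> / \<epsilon>\<close>, on which the integrand is at most \<open>exp (- \<beta> * h)\<close>.  For large \<open>\<kappa>\<close> the integral over all
  \<open>t \<ge> h\<close>, finite because \<open>k < \<beta>\<close>, is good enough.\<close>

lemma nn_integral_subtree_weight_le:
  fixes \<epsilon> \<beta> k h \<sigma> :: real
  assumes "0 < \<epsilon>" "0 \<le> k" "k < \<beta>" "0 < \<sigma>"
  shows "(\<integral>\<^sup>+t\<in>{t. h \<le> t \<and> root_dist \<epsilon> t < root_dist \<epsilon> h + \<sigma>}. ennreal (exp (k * (t - h) - \<beta> * t)) \<partial>lborel)
    \<le> ennreal (max (2 / (\<beta> - k)) (2 / \<epsilon>) * exp (- \<beta> * h) * min 1 (\<epsilon> * \<sigma> * exp (\<epsilon> * h)))"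
    (is "?L \<le> ennreal (?M * _ * min 1 ?\<kappa>)")
proof -
  let ?I = "{t. h \<le> t \<and> root_dist \<epsilon> t < root_dist \<epsilon> h + \<sigma>}" and ?\<gamma> = "\<beta> - k"
  have \<kappa>: "0 < ?\<kappa>" using assms by simp
  have eq: "exp (k * (t - h) - \<beta> * t) = exp (- \<beta> * h) * exp (- ?\<gamma> * (t - h))" for t
    by (simp add: algebra_simps flip: exp_add)
  show ?thesis
  proof (cases "?\<kappa> < 1 / 2")
    case True
    have I: "t \<le> h + 2 * ?\<kappa> / \<epsilon>" if t: "t \<in> ?I" for t
    proof (rule ccontr)
      assume "\<not> t \<le> h + 2 * ?\<kappa> / \<epsilon>"
      then have "2 * ?\<kappa> / \<epsilon> < t - h" by linarith
      then have "2 * ?\<kappa> < (t - h) * \<epsilon>" by (simp only: pos_divide_less_eq[OF assms(1)])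
      then have "exp (- \<epsilon> * (t - h)) < exp (- (2 * ?\<kappa>))"
        by (simp only: exp_less_cancel_iff mult_minus_left neg_less_iff_less mult.commute[of "t - h" \<epsilon>])
      also have "\<dots> \<le> 1 / (1 + 2 * ?\<kappa>)"
        using exp_ge_add_one_self[of "2 * ?\<kappa>"] \<kappa> by (simp add: exp_minus field_simps)
      also have "\<dots> \<le> 1 - ?\<kappa>"
      proof -
        have "2 * ?\<kappa> * ?\<kappa> \<le> 1 * ?\<kappa>" using True \<kappa> by (intro mult_right_mono) auto
        then have "1 \<le> (1 - ?\<kappa>) * (1 + 2 * ?\<kappa>)" by (simp add: algebra_simps)
        then show ?thesis using \<kappa> by (simp add: divide_le_eq)
      qed
      finally have 1: "exp (- \<epsilon> * (t - h)) < 1 - ?\<kappa>" .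
      have "\<epsilon> * root_dist \<epsilon> t < \<epsilon> * (root_dist \<epsilon> h + \<sigma>)"
        using t assms(1) by simp
      then have "exp (- \<epsilon> * h) - \<epsilon> * \<sigma> < exp (- \<epsilon> * t)"
        using assms(1) by (simp add: exp_root_dist algebra_simps)
      then have "exp (\<epsilon> * h) * (exp (- \<epsilon> * h) - \<epsilon> * \<sigma>) < exp (\<epsilon> * h) * exp (- \<epsilon> * t)"
        by simp
      then have "1 - ?\<kappa> < exp (- \<epsilon> * (t - h))"
        by (simp add: algebra_simps flip: exp_add)
      with 1 show False by simp
    qed
    have "?L \<le> (\<integral>\<^sup>+t. ennreal (exp (- \<beta> * h)) * indicator {h..h + 2 * ?\<kappa> / \<epsilon>} t \<partial>lborel)"
    proof (intro nn_integral_mono)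
      fix t
      have "exp (k * (t - h) - \<beta> * t) \<le> exp (- \<beta> * h)" if "h \<le> t"
        unfolding eq using that assms(3) by (simp add: mult_le_0_iff mult_nonneg_nonneg)
      then show "ennreal (exp (k * (t - h) - \<beta> * t)) * indicator ?I t
          \<le> ennreal (exp (- \<beta> * h)) * indicator {h..h + 2 * ?\<kappa> / \<epsilon>} t"
        using I[of t] assms(1) by (auto split: split_indicator intro!: ennreal_leI)
    qed
    also have "\<dots> = ennreal (exp (- \<beta> * h) * (2 * ?\<kappa> / \<epsilon>))"
    proof -
      have "emeasure lborel {h..h + 2 * ?\<kappa> / \<epsilon>} = ennreal (2 * ?\<kappa> / \<epsilon>)"
        using assms(1,4) by (subst emeasure_lborel_Icc) auto
      then show ?thesis
        by (subst nn_integral_cmult_indicator) (simp_all only: ennreal_mult'[OF exp_ge_zero], simp)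
    qed
    also have "\<dots> \<le> ennreal (?M * exp (- \<beta> * h) * min 1 ?\<kappa>)"
    proof (rule ennreal_leI)
      have min: "min 1 ?\<kappa> = ?\<kappa>" using True by simp
      have "exp (- \<beta> * h) * (2 * ?\<kappa> / \<epsilon>) = 2 / \<epsilon> * (exp (- \<beta> * h) * ?\<kappa>)" by simp
      also have "\<dots> \<le> ?M * (exp (- \<beta> * h) * ?\<kappa>)"
        using \<kappa> by (intro mult_right_mono) auto
      finally show "exp (- \<beta> * h) * (2 * ?\<kappa> / \<epsilon>) \<le> ?M * exp (- \<beta> * h) * min 1 ?\<kappa>"
        unfolding min by (simp only: mult.assoc)
    qed
    finally show ?thesis .
  next
    case False
    let ?F = "\<lambda>t. - exp (- \<beta> * h) * exp (- ?\<gamma> * (t - h)) / ?\<gamma>"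
    have deriv: "DERIV (\<lambda>t. - c * exp (- a * (t - h)) / a) t :> c * exp (- a * (t - h))"
      if "a \<noteq> 0" for a c t
      using that by (auto intro!: derivative_eq_intros)
    have "?L \<le> (\<integral>\<^sup>+t. ennreal (exp (- \<beta> * h) * exp (- ?\<gamma> * (t - h))) * indicator {h..} t \<partial>lborel)"
      unfolding eq by (intro nn_integral_mono) (auto split: split_indicator)
    also have "\<dots> = ennreal (0 - ?F h)"
    proof (rule nn_integral_FTC_atLeast[where F = ?F])
      show "(?F \<longlongrightarrow> 0) at_top"
        using assms(3) by real_asymp
      show "DERIV ?F t :> exp (- \<beta> * h) * exp (- ?\<gamma> * (t - h))" for t
        using deriv[of ?\<gamma>] assms(3) by simp
    qed auto
    also have "\<dots> \<le> ennreal (?M * exp (- \<beta> * h) * min 1 ?\<kappa>)"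
    proof (rule ennreal_leI)
      have "0 - - a * exp (- b * (h - h)) / b = 2 / b * (a * (1 / 2))" for a b :: real by simp
      then have "0 - ?F h = 2 / ?\<gamma> * (exp (- \<beta> * h) * (1 / 2))" .
      also have "\<dots> \<le> ?M * (exp (- \<beta> * h) * min 1 ?\<kappa>)"
        using False assms(1,3) by (intro mult_mono) (auto simp: le_max_iff_disj)
      finally show "0 - ?F h \<le> ?M * exp (- \<beta> * h) * min 1 ?\<kappa>"
        by (simp only: mult.assoc)
    qed
    finally show ?thesis .
  qed
qed

locale bounded_tree = leafless_tree V E root
  for V :: "'v set" and E :: "('v \<times> 'v) set" and root :: 'v +
  fixes K :: nat
  assumes finite_children: "v \<in> V \<Longrightarrow> finite (children v)"
    and card_children: "v \<in> V \<Longrightarrow> card (children v) \<le> K"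
begin

lemma K_pos: "1 \<le> K"
proof -
  have "0 < card (children root)"
    using children_nonempty[OF root_in] finite_children[OF root_in] by (simp add: card_gt_0_iff)
  then show ?thesis using card_children[OF root_in] by linarith
qed

definition subtree_edges :: "'v \<Rightarrow> nat \<Rightarrow> nat \<Rightarrow> ('v \<times> 'v) set" where
  "subtree_edges v m n = {(w n, w (Suc n)) | w. ray w \<and> w m = v \<and> m \<le> n}"

lemma subtree_edgesE:
  assumes "e \<in> subtree_edges v m n"
  obtains w where "ray w" "w m = v" "m \<le> n" "e = (w n, w (Suc n))"
  using assms by (auto simp: subtree_edges_def)

lemma card_subtree_edges: "finite (subtree_edges v m (m + j)) \<and> card (subtree_edges v m (m + j)) \<le> K ^ Suc j"
proof -
  have children: "w (Suc n) \<in> children (w n)" if "ray w" for w n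
    using ray_edge[OF that, of n] by (auto simp: edges_def)
  have step: "finite (Sigma U children) \<and> card (Sigma U children) \<le> k * K"
    if "finite U" "U \<subseteq> V" "card U \<le> k" for U k
  proof
    show "finite (Sigma U children)" using that finite_children by auto
    have "card (Sigma U children) = (\<Sum>u\<in>U. card (children u))"
      using that finite_children by (intro card_SigmaI) auto
    also have "\<dots> \<le> (\<Sum>u\<in>U. K)" using that card_children by (intro sum_mono) auto
    also have "\<dots> \<le> k * K" using that(3) by simp
    finally show "card (Sigma U children) \<le> k * K" .
  qed
  define L where "L n = {w n | w. ray w \<and> w m = v}" for n
  have LV: "L n \<subseteq> V" for n using ray_V by (auto simp: L_def)
  have "finite (L (m + j)) \<and> card (L (m + j)) \<le> K ^ j"
  proof (induction j)
    case 0
    have "L m \<subseteq> {v}" by (auto simp: L_def)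
    then have "finite (L m)" "card (L m) \<le> 1"
      using finite_subset card_mono[of "{v}" "L m"] by auto
    then show ?case by simp
  next
    case (Suc j)
    let ?S = "Sigma (L (m + j)) children"
    have S: "finite ?S" "card ?S \<le> K ^ j * K"
      using step[OF _ LV, of "m + j"] Suc by auto
    have "L (m + Suc j) \<subseteq> snd ` ?S"
      using children by (force simp: L_def)
    then have "finite (L (m + Suc j))" "card (L (m + Suc j)) \<le> card ?S"
      using S(1) by (auto intro: finite_subset card_mono[THEN order_trans] card_image_le)
    then show ?case using S(2) by (simp add: mult.commute)
  qed
  then have S: "finite (Sigma (L (m + j)) children)" "card (Sigma (L (m + j)) children) \<le> K ^ j * K"
    using step[OF _ LV, of "m + j"] by auto
  have "subtree_edges v m (m + j) \<subseteq> Sigma (L (m + j)) children"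
    using children by (auto simp: subtree_edges_def L_def)
  then have "finite (subtree_edges v m (m + j))" "card (subtree_edges v m (m + j)) \<le> K ^ j * K"
    using S finite_subset order_trans[OF card_mono[OF S(1)]] by blast+
  then show ?thesis by (simp add: mult.commute)
qed

lemma emeasure_tree_measure:
  assumes "A \<in> sets length_measure"
  shows "emeasure (tree_measure \<beta>) A = (\<integral>\<^sup>+z\<in>A. ennreal (exp (- \<beta> * height z)) \<partial>length_measure)"
  unfolding tree_measure_def using assms by (intro emeasure_density) measurable

text \<open>There are at most \<open>K ^ (n - m + 1)\<close> edges at level \<open>n\<close> in the subtree of \<open>v\<close>, and \<open>n \<le> t\<close> for every height \<open>t\<close>
  on such an edge.  Hence \<open>K * K powr (t - m)\<close> bounds the number of points of \<open>A\<close> at height \<open>t\<close>.\<close>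

lemma emeasure_subtree_le:
  assumes A: "A \<in> sets length_measure" "\<And>x. x \<in> A \<Longrightarrow> \<exists>w t. ray w \<and> w m = v \<and> t \<in> I \<and> x = ray_point w t"
    and I: "I \<in> sets borel" "I \<subseteq> {real m..}"
  shows "emeasure (tree_measure \<beta>) A
    \<le> (\<integral>\<^sup>+t\<in>I. ennreal (real K * exp (ln (real K) * (t - real m) - \<beta> * t)) \<partial>lborel)"
proof -
  note [measurable] = A(1)
  define g where "g t = ennreal (exp (- \<beta> * t)) * indicator I t" for t
  have [measurable]: "g \<in> borel_measurable borel" using I(1) unfolding g_def by measurable
  define \<phi> where "\<phi> n = (\<integral>\<^sup>+\<tau>\<in>{0..1}. g (real n + \<tau>) \<partial>lborel)" for n
  (* endpoints are left out: the vertex v is also the upper end of the edge from its parent *)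
  have inside: "e \<in> subtree_edges v m (level (fst e)) \<and> level (fst e) + \<tau> \<in> I"
    if e: "e \<in> edges" "0 < \<tau>" "\<tau> < 1" "on_edge e \<tau> \<in> A" for e and \<tau> :: real
  proof -
    obtain w t where w: "ray w" "w m = v" "t \<in> I" "on_edge e \<tau> = ray_point w t" using A(2) e(4) by blast
    have t: "real m \<le> t" using w(3) I(2) by auto
    have "0 \<le> t" using t by (rule order_trans[rotated]) simp
    obtain n \<sigma> where n: "t = real n + \<sigma>" "0 \<le> \<sigma>" "\<sigma> < 1"
      using nonneg_real_cases \<open>0 \<le> t\<close> by blast
    have "e = (w n, w (Suc n)) \<and> \<sigma> = \<tau>"
      using w(4) n e(2,3) by (cases e) (auto simp: ray_point_on_edge split: if_splits)
    moreover have "m \<le> n" using t n by linarith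
    ultimately show ?thesis using w n level_ray[OF w(1)] by (auto simp: subtree_edges_def)
  qed
  have level: "level (fst e) = n" if "e \<in> subtree_edges v m n" for e n
    using that level_ray by (auto elim: subtree_edgesE)
  have "emeasure (tree_measure \<beta>) A
      = (\<integral>\<^sup>+e. (\<integral>\<^sup>+\<tau>\<in>{0..1}. (ennreal (exp (- \<beta> * height (on_edge e \<tau>))) * indicator A (on_edge e \<tau>)) \<partial>lborel)
          \<partial>count_space edges)"
    unfolding emeasure_tree_measure[OF A(1)] using A(1) by (intro nn_integral_length_measure) measurable
  also have "\<dots> \<le> (\<integral>\<^sup>+e. \<phi> (level (fst e)) * indicator (subtree_edges v m (level (fst e))) e \<partial>count_space edges)"
  proof (intro nn_integral_mono)
    fix e assume "e \<in> space (count_space edges)"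
    then have e: "e \<in> edges" by simp
    let ?k = "level (fst e)" and ?b = "indicator (subtree_edges v m (level (fst e))) e :: ennreal"
    have "(\<integral>\<^sup>+\<tau>\<in>{0..1}. (ennreal (exp (- \<beta> * height (on_edge e \<tau>))) * indicator A (on_edge e \<tau>)) \<partial>lborel)
        \<le> (\<integral>\<^sup>+\<tau>. g (real ?k + \<tau>) * indicator {0..1} \<tau> * ?b \<partial>lborel)"
    proof (rule nn_integral_mono_AE)
      show "AE \<tau> in lborel. ennreal (exp (- \<beta> * height (on_edge e \<tau>))) * indicator A (on_edge e \<tau>) * indicator {0..1} \<tau>
          \<le> g (real ?k + \<tau>) * indicator {0..1} \<tau> * ?b"
        using AE_lborel_singleton[of "0::real"] AE_lborel_singleton[of "1::real"]
      proof eventually_elim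
        case (elim \<tau>)
        show ?case
        proof (cases "\<tau> \<in> {0..1} \<and> on_edge e \<tau> \<in> A")
          case True
          then have \<tau>: "0 < \<tau>" "\<tau> < 1" using elim by auto
          show ?thesis using inside[OF e \<tau>] True height_on_edge[OF e, of \<tau>] by (simp add: g_def)
        next
          case False
          then show ?thesis by (auto split: split_indicator)
        qed
      qed
    qed
    also have "\<dots> = \<phi> ?k * ?b" unfolding \<phi>_def by (rule nn_integral_multc) measurable
    finally show "(\<integral>\<^sup>+\<tau>\<in>{0..1}. (ennreal (exp (- \<beta> * height (on_edge e \<tau>))) * indicator A (on_edge e \<tau>)) \<partial>lborel)
        \<le> \<phi> ?k * ?b" .
  qed
  (* sort the edges by level: only the term of the level of e survives *)
  also have "\<dots> = (\<integral>\<^sup>+e. (\<Sum>n. \<phi> n * indicator (subtree_edges v m n) e) \<partial>count_space edges)"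
  proof (intro nn_integral_cong)
    fix e :: "'v \<times> 'v"
    have "(\<Sum>n. \<phi> n * indicator (subtree_edges v m n) e) = (\<Sum>n\<in>{level (fst e)}. \<phi> n * indicator (subtree_edges v m n) e)"
      using level[of e] by (intro suminf_finite) (auto split: split_indicator)
    then show "\<phi> (level (fst e)) * indicator (subtree_edges v m (level (fst e))) e
        = (\<Sum>n. \<phi> n * indicator (subtree_edges v m n) e)"
      by (simp del: sum_mult_indicator)
  qed
  also have "\<dots> = (\<Sum>n. \<integral>\<^sup>+e. \<phi> n * indicator (subtree_edges v m n) e \<partial>count_space edges)"
    by (intro nn_integral_suminf) auto
  also have "\<dots> \<le> (\<Sum>n. \<integral>\<^sup>+\<tau>\<in>{0..1}. (g (real n + \<tau>) * ennreal (real K * exp (ln (real K) * (real n + \<tau> - real m)))) \<partial>lborel)"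
  proof (intro suminf_le)
    fix n
    show "(\<integral>\<^sup>+e. \<phi> n * indicator (subtree_edges v m n) e \<partial>count_space edges)
        \<le> (\<integral>\<^sup>+\<tau>\<in>{0..1}. (g (real n + \<tau>) * ennreal (real K * exp (ln (real K) * (real n + \<tau> - real m)))) \<partial>lborel)"
    proof (cases "m \<le> n")
      case False
      then show ?thesis by (auto simp: subtree_edges_def)
    next
      case True
      then obtain j where n: "n = m + j" using le_Suc_ex by blast
      have sub: "subtree_edges v m n \<subseteq> edges" using ray_edge by (auto elim: subtree_edgesE)
      have fin: "finite (subtree_edges v m n)" "card (subtree_edges v m n) \<le> K ^ Suc j"
        using card_subtree_edges n by auto
      have "(\<integral>\<^sup>+e. \<phi> n * indicator (subtree_edges v m n) e \<partial>count_space edges)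
          = \<phi> n * ennreal (card (subtree_edges v m n))"
        using sub fin by (simp add: nn_integral_cmult_indicator ennreal_of_nat_eq_real_of_nat)
      also have "\<dots> \<le> \<phi> n * ennreal (real K ^ Suc j)"
        using fin(2) by (intro mult_left_mono ennreal_leI) (simp_all flip: of_nat_power of_nat_mult)
      also have "\<dots> = (\<integral>\<^sup>+\<tau>. g (real n + \<tau>) * indicator {0..1} \<tau> * ennreal (real K ^ Suc j) \<partial>lborel)"
        unfolding \<phi>_def by (rule nn_integral_multc[symmetric]) measurable
      also have "\<dots> \<le> (\<integral>\<^sup>+\<tau>\<in>{0..1}. (g (real n + \<tau>) * ennreal (real K * exp (ln (real K) * (real n + \<tau> - real m)))) \<partial>lborel)"
      proof (intro nn_integral_mono)
        fix \<tau> :: real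
        have "real K ^ j \<le> exp (ln (real K) * (real n + \<tau> - real m))" if "0 \<le> \<tau>"
        proof -
          have "real K ^ j = exp (ln (real K) * real j)"
            using K_pos by (simp add: mult.commute exp_of_nat_mult)
          also have "\<dots> \<le> exp (ln (real K) * (real n + \<tau> - real m))"
            using that K_pos n by (simp add: mult_left_mono)
          finally show ?thesis .
        qed
        then show "g (real n + \<tau>) * indicator {0..1} \<tau> * ennreal (real K ^ Suc j)
            \<le> g (real n + \<tau>) * ennreal (real K * exp (ln (real K) * (real n + \<tau> - real m))) * indicator {0..1} \<tau>"
          by (auto split: split_indicator intro!: mult_left_mono ennreal_leI)
      qed
      finally show ?thesis .
    qed
  qed auto
  also have "\<dots> = (\<integral>\<^sup>+t. g t * ennreal (real K * exp (ln (real K) * (t - real m))) \<partial>lborel)"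
  proof (rule nn_integral_unit_intervals)
    show "g t * ennreal (real K * exp (ln (real K) * (t - real m))) = 0" if "t < 0" for t
      using that I(2) by (auto simp: g_def split: split_indicator)
  qed measurable
  also have "\<dots> = (\<integral>\<^sup>+t\<in>I. ennreal (real K * exp (ln (real K) * (t - real m) - \<beta> * t)) \<partial>lborel)"
    by (intro nn_integral_cong)
      (auto simp: g_def exp_diff exp_minus divide_inverse mult_ac split: split_indicator simp flip: ennreal_mult)
  finally show ?thesis .
qed

lemma emeasure_ray_ge:
  assumes "ray w" "0 \<le> h" "0 \<le> L" "0 \<le> \<beta>"
  shows "ennreal (L * exp (- \<beta> * (h + L))) \<le> emeasure (tree_measure \<beta>) (ray_point w ` {h..<h + L})"
proof -
  have "ennreal (L * exp (- \<beta> * (h + L))) = (\<integral>\<^sup>+t. ennreal (exp (- \<beta> * (h + L))) * indicator {h..<h + L} t \<partial>lborel)"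
    using assms(3) by (subst nn_integral_cmult_indicator) (simp_all add: mult.commute flip: ennreal_mult)
  also have "\<dots> \<le> (\<integral>\<^sup>+t\<in>{h..<h + L}. ennreal (exp (- \<beta> * t)) \<partial>lborel)"
    using assms(4) by (intro nn_integral_mono)
      (auto split: split_indicator intro!: ennreal_leI mult_left_mono)
  also have "\<dots> = emeasure (tree_measure \<beta>) (ray_point w ` {h..<h + L})"
  proof -
    have B: "{h..<h + L} \<subseteq> {0..}" "{h..<h + L} \<in> sets borel" using assms(2) by auto
    show ?thesis unfolding emeasure_tree_measure[OF ray_image_sets[OF assms(1) B]]
      by (rule nn_integral_ray[OF assms(1) B, symmetric]) measurable
  qed
  finally show ?thesis .
qed

text \<open>A path from \<open>x\<close> to a point of the ball cannot descend further than \<open>R\<close>, so the last common ancestor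
  has height at least \<open>h\<close>; and from height \<open>h\<close> the point is reached within the distance \<open>2 * R\<close>.\<close>

lemma emeasure_ball_le:
  assumes "0 < \<epsilon>" "ln (real K) < \<beta>" "ray w" "0 \<le> s" "0 < R"
    and h: "0 \<le> h" "h \<le> s" "root_dist \<epsilon> h = max (root_dist \<epsilon> s - R) 0"
  shows "emeasure (tree_measure \<beta>) (tree_ball \<epsilon> (ray_point w s) R)
    \<le> ennreal (real K ^ 2 * (max (2 / (\<beta> - ln (real K))) (2 / \<epsilon>) * exp (- \<beta> * h)
        * min 1 (\<epsilon> * (2 * R) * exp (\<epsilon> * h))))"
proof -
  let ?B = "tree_ball \<epsilon> (ray_point w s) R" and ?k = "ln (real K)"
  (* the ancestor of x at height h may be interior to an edge; replacing it by the vertex at the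
     lower end of that edge costs one more factor K *)
  define m where "m = nat \<lfloor>h\<rfloor>"
  have m: "real m \<le> h" "h < real m + 1" using h(1) by (simp_all add: m_def floor_correct)
  have k: "0 \<le> ?k" using K_pos by simp
  let ?I = "{t. h \<le> t \<and> root_dist \<epsilon> t < root_dist \<epsilon> h + 2 * R}"
  have I [measurable]: "?I \<in> sets borel" unfolding root_dist_def by measurable
  have B: "?B \<in> sets length_measure" using assms by (intro tree_ball_sets ray_point_in)
  have "\<exists>w' t. ray w' \<and> w' m = w m \<and> t \<in> ?I \<and> y = ray_point w' t" if y: "y \<in> ?B" for y
  proof -
    have "y \<in> points" and d: "tree_dist \<epsilon> (ray_point w s) y < R" using y by (auto simp: tree_ball_def)
    then obtain w' t where w': "ray w'" "0 \<le> t" "y = ray_point w' t" using point_on_ray by blast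
    obtain c where c: "meet_height w w' s t c" using ex_meet_height assms(3,4) w' by blast
    have cs: "0 \<le> c" "c \<le> s" "c \<le> t" "ray_point w c = ray_point w' c"
      using c by (auto simp: meet_height_def)
    have d: "root_dist \<epsilon> s + root_dist \<epsilon> t - 2 * root_dist \<epsilon> c < R"
      using d tree_dist_ray_point[OF assms(1,3) w'(1) c] w'(3) by simp
    have mono: "root_dist \<epsilon> c \<le> root_dist \<epsilon> s" "root_dist \<epsilon> c \<le> root_dist \<epsilon> t" "0 \<le> root_dist \<epsilon> c"
      using cs assms(1) by (auto intro: root_dist_mono root_dist_nonneg)
    then have "root_dist \<epsilon> h \<le> root_dist \<epsilon> c" using d h(3) by auto
    then have "h \<le> c" using root_dist_le_iff assms(1) by blast
    then have "ray_point w (real m) = ray_point w' (real m)"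
      using m by (intro ray_point_eq_down[OF assms(3) w'(1) _ _ cs(4)]) auto
    then have "w' m = w m" using ray_point_eq_iff[OF assms(3) w'(1), of "real m"] by simp
    moreover have "root_dist \<epsilon> t < root_dist \<epsilon> h + 2 * R" using d mono h(3) by linarith
    ultimately show ?thesis using w' cs \<open>h \<le> c\<close> by (intro exI[of _ w'] exI[of _ t]) auto
  qed
  then have "emeasure (tree_measure \<beta>) ?B
      \<le> (\<integral>\<^sup>+t\<in>?I. ennreal (real K * exp (?k * (t - real m) - \<beta> * t)) \<partial>lborel)"
    using m(1) by (intro emeasure_subtree_le B I) auto
  also have "\<dots> \<le> (\<integral>\<^sup>+t. ennreal (real K ^ 2) * (ennreal (exp (?k * (t - h) - \<beta> * t)) * indicator ?I t) \<partial>lborel)"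
  proof (intro nn_integral_mono)
    fix t
    have "?k * (h - real m) \<le> ?k * 1" using m k by (intro mult_left_mono) auto
    then have "?k * (t - real m) - \<beta> * t \<le> ?k + (?k * (t - h) - \<beta> * t)" by (simp add: algebra_simps)
    then have "exp (?k * (t - real m) - \<beta> * t) \<le> exp (?k + (?k * (t - h) - \<beta> * t))" by simp
    also have "\<dots> = real K * exp (?k * (t - h) - \<beta> * t)" using K_pos by (simp add: exp_add)
    finally have "real K * exp (?k * (t - real m) - \<beta> * t) \<le> real K * (real K * exp (?k * (t - h) - \<beta> * t))"
      by (rule mult_left_mono) simp
    then show "ennreal (real K * exp (?k * (t - real m) - \<beta> * t)) * indicator ?I t
        \<le> ennreal (real K ^ 2) * (ennreal (exp (?k * (t - h) - \<beta> * t)) * indicator ?I t)"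
      by (auto split: split_indicator intro!: ennreal_leI simp: power2_eq_square mult.assoc simp flip: ennreal_mult)
  qed
  also have "\<dots> = ennreal (real K ^ 2) * (\<integral>\<^sup>+t\<in>?I. ennreal (exp (?k * (t - h) - \<beta> * t)) \<partial>lborel)"
    by (intro nn_integral_cmult) measurable
  also have "\<dots> \<le> ennreal (real K ^ 2) * ennreal (max (2 / (\<beta> - ?k)) (2 / \<epsilon>) * exp (- \<beta> * h)
        * min 1 (\<epsilon> * (2 * R) * exp (\<epsilon> * h)))"
    using assms(1,2,5) k by (intro mult_left_mono nn_integral_subtree_weight_le) auto
  finally show ?thesis
    using assms(1,5) by (subst ennreal_mult') auto
qed

text \<open>The piece of the ray through \<open>x\<close> that starts at height \<open>h\<close> and has weighted length at most \<open>R\<close> stays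
  in the ball.  The weight is at most \<open>exp (- \<epsilon> * h)\<close> on it, so unweighted length
  \<open>R * exp (\<epsilon> * h)\<close> is allowed; cutting it off at \<open>1 / \<epsilon>\<close> keeps the density of the measure
  comparable to \<open>exp (- \<beta> * h)\<close>.\<close>

lemma emeasure_ball_ge:
  assumes "0 < \<epsilon>" "0 \<le> \<beta>" "ray w" "0 \<le> s" "0 < R"
    and h: "0 \<le> h" "h \<le> s" "root_dist \<epsilon> h = max (root_dist \<epsilon> s - R) 0"
  shows "ennreal (exp (- \<beta> / \<epsilon>) / \<epsilon> * exp (- \<beta> * h) * min 1 (\<epsilon> * R * exp (\<epsilon> * h)))
    \<le> emeasure (tree_measure \<beta>) (tree_ball \<epsilon> (ray_point w s) (2 * R))"
proof -
  define L where "L = min 1 (\<epsilon> * R * exp (\<epsilon> * h)) / \<epsilon>"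
  have L: "0 \<le> L" "L \<le> 1 / \<epsilon>" "L \<le> R * exp (\<epsilon> * h)"
    using assms(1,5) by (auto simp: L_def divide_simps mult_ac min_def)
  have "ray_point w t \<in> tree_ball \<epsilon> (ray_point w s) (2 * R)" if t: "t \<in> {h..<h + L}" for t
  proof -
    have "1 - \<epsilon> * (t - h) \<le> exp (- \<epsilon> * (t - h))"
      using exp_ge_add_one_self[of "- \<epsilon> * (t - h)"] by simp
    then have "exp (- \<epsilon> * h) * (1 - exp (- \<epsilon> * (t - h))) \<le> exp (- \<epsilon> * h) * (\<epsilon> * (t - h))"
      by (intro mult_left_mono) auto
    also have "\<dots> \<le> exp (- \<epsilon> * h) * (\<epsilon> * (R * exp (\<epsilon> * h)))"
      using t L(3) assms(1) by (intro mult_left_mono) auto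
    also have "\<dots> = \<epsilon> * R" by (simp flip: exp_add)
    finally have "exp (- \<epsilon> * h) - exp (- \<epsilon> * t) \<le> \<epsilon> * R"
      by (simp add: algebra_simps flip: exp_add)
    then have "\<epsilon> * root_dist \<epsilon> t \<le> \<epsilon> * (root_dist \<epsilon> h + R)"
      using assms(1) by (simp add: exp_root_dist algebra_simps)
    then have up: "root_dist \<epsilon> t \<le> root_dist \<epsilon> h + R" using assms(1) by simp
    have lo: "root_dist \<epsilon> h \<le> root_dist \<epsilon> t" "root_dist \<epsilon> h \<le> root_dist \<epsilon> s"
      using root_dist_mono[OF assms(1)] t h(2) by auto
    have t0: "0 \<le> t" using t h by auto
    have "tree_dist \<epsilon> (ray_point w s) (ray_point w t) = root_dist \<epsilon> s + root_dist \<epsilon> t - 2 * root_dist \<epsilon> (min s t)"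
      by (rule tree_dist_ray_point[OF assms(1,3,3) meet_height_same[OF assms(4) t0]])
    also have "\<dots> < 2 * R" using up lo h(3) assms(5) by (auto simp: min_def)
    finally show ?thesis using ray_point_in[OF assms(3) t0] by (simp add: tree_ball_def)
  qed
  then have sub: "ray_point w ` {h..<h + L} \<subseteq> tree_ball \<epsilon> (ray_point w s) (2 * R)" by blast
  have "\<beta> * L \<le> \<beta> / \<epsilon>" using L(2) assms(2) mult_left_mono[of L "1 / \<epsilon>" \<beta>] by simp
  then have "L * (exp (- \<beta> / \<epsilon>) * exp (- \<beta> * h)) \<le> L * exp (- \<beta> * (h + L))"
    using L(1) by (intro mult_left_mono) (auto simp: algebra_simps simp flip: exp_add)
  then have "ennreal (exp (- \<beta> / \<epsilon>) / \<epsilon> * exp (- \<beta> * h) * min 1 (\<epsilon> * R * exp (\<epsilon> * h)))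
      \<le> ennreal (L * exp (- \<beta> * (h + L)))"
    by (intro ennreal_leI) (simp add: L_def mult_ac)
  also have "\<dots> \<le> emeasure (tree_measure \<beta>) (ray_point w ` {h..<h + L})"
    by (rule emeasure_ray_ge[OF assms(3) h(1) L(1) assms(2)])
  also have "\<dots> \<le> emeasure (tree_measure \<beta>) (tree_ball \<epsilon> (ray_point w s) (2 * R))"
    using sub tree_ball_sets[OF assms(1) ray_point_in[OF assms(3,4)]]
    by (intro emeasure_mono) (auto simp: tree_measure_def)
  finally show ?thesis .
qed

text \<open>The bounds of \<open>emeasure_ball_le\<close> and \<open>emeasure_ball_ge\<close> are taken at the heights \<open>h \<le> h'\<close> that lie
  \<open>2 * r\<close> and \<open>r / 2\<close> from \<open>x\<close> towards the root.  Since \<open>exp (- \<epsilon> * h)\<close> and \<open>exp (- \<epsilon> * h')\<close> are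
  \<open>\<epsilon>\<close> times the distances of these points to the boundary at infinity, the first is at most four times the
  second.\<close>

lemma doubling:
  assumes "0 < \<epsilon>" "ln (real K) < \<beta>"
  shows "\<exists>C::real. \<forall>x\<in>points. \<forall>r>0. emeasure (tree_measure \<beta>) (tree_ball \<epsilon> x (2 * r))
    \<le> ennreal C * emeasure (tree_measure \<beta>) (tree_ball \<epsilon> x r)"
proof -
  have "0 \<le> ln (real K)" using K_pos by simp
  then have \<beta>: "0 \<le> \<beta>" using assms(2) by linarith
  let ?M = "max (2 / (\<beta> - ln (real K))) (2 / \<epsilon>)" and ?c = "exp (- \<beta> / \<epsilon>) / \<epsilon>"
  define C where "C = real K ^ 2 * ?M * exp (\<beta> * ln 4 / \<epsilon>) * 8 / ?c"
  have M: "0 \<le> ?M" using assms(1) by (simp add: le_max_iff_disj)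
  have c: "0 < ?c" using assms(1) by simp
  have "emeasure (tree_measure \<beta>) (tree_ball \<epsilon> x (2 * r))
      \<le> ennreal C * emeasure (tree_measure \<beta>) (tree_ball \<epsilon> x r)"
    if x: "x \<in> points" and r: "0 < r" for x r
  proof -
    obtain w s where w: "ray w" "0 \<le> s" "x = ray_point w s" using point_on_ray x by blast
    obtain h where h: "0 \<le> h" "h \<le> s" "root_dist \<epsilon> h = max (root_dist \<epsilon> s - 2 * r) 0"
      using ex_height_towards_root[OF assms(1) w(2), of "2 * r"] r by auto
    obtain h' where h': "0 \<le> h'" "h' \<le> s" "root_dist \<epsilon> h' = max (root_dist \<epsilon> s - r / 2) 0"
      using ex_height_towards_root[OF assms(1) w(2), of "r / 2"] r by auto
    have "h \<le> h'" using h(3) h'(3) r root_dist_le_iff[OF assms(1), of h h'] by auto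
    let ?f = "root_dist \<epsilon> s"
    have f: "0 \<le> ?f" "\<epsilon> * ?f \<le> 1"
      using root_dist_nonneg[OF assms(1) w(2)] exp_ge_zero[of "- (\<epsilon> * s)"]
      unfolding exp_root_dist[OF assms(1)] by simp_all
    have "exp (- \<epsilon> * h) \<le> 4 * exp (- \<epsilon> * h')"
      unfolding mult_minus_left exp_root_dist[OF assms(1)] h(3) h'(3)
    proof (cases "?f \<le> 2 * r")
      case True
      then have "\<epsilon> * max (?f - r / 2) 0 \<le> \<epsilon> * (3 / 4 * ?f)"
        using f assms(1) by (intro mult_left_mono max.boundedI) auto
      then show "1 - \<epsilon> * max (?f - 2 * r) 0 \<le> 4 * (1 - \<epsilon> * max (?f - r / 2) 0)"
        using True f(2) by simp
    next
      case False
      then show "1 - \<epsilon> * max (?f - 2 * r) 0 \<le> 4 * (1 - \<epsilon> * max (?f - r / 2) 0)"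
        using f(2) r by (simp add: algebra_simps)
    qed
    also have "\<dots> = exp (ln 4 - \<epsilon> * h')" by (simp add: exp_diff exp_minus divide_inverse)
    finally have "h' \<le> h + ln 4 / \<epsilon>" using assms(1) by (simp add: field_simps)
    then have "\<beta> * h' \<le> \<beta> * (h + ln 4 / \<epsilon>)" using \<beta> by (rule mult_left_mono)
    then have 1: "exp (- \<beta> * h) \<le> exp (\<beta> * ln 4 / \<epsilon>) * exp (- \<beta> * h')"
      by (simp add: algebra_simps flip: exp_add)
    have "\<epsilon> * (2 * (2 * r)) * exp (\<epsilon> * h) \<le> \<epsilon> * (2 * (2 * r)) * exp (\<epsilon> * h')"
      using \<open>h \<le> h'\<close> assms(1) r by (intro mult_left_mono) auto
    (* 8 is the quotient of 2 * (2 * r) and r / 2 *)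
    then have 2: "min 1 (\<epsilon> * (2 * (2 * r)) * exp (\<epsilon> * h)) \<le> 8 * min 1 (\<epsilon> * (r / 2) * exp (\<epsilon> * h'))"
      by (auto simp: min_def)
    let ?low = "?c * exp (- \<beta> * h') * min 1 (\<epsilon> * (r / 2) * exp (\<epsilon> * h'))"
    have "emeasure (tree_measure \<beta>) (tree_ball \<epsilon> x (2 * r))
        \<le> ennreal (real K ^ 2 * (?M * exp (- \<beta> * h) * min 1 (\<epsilon> * (2 * (2 * r)) * exp (\<epsilon> * h))))"
      unfolding w(3) using r by (intro emeasure_ball_le assms w h) auto
    also have "\<dots> \<le> ennreal (real K ^ 2 * (?M * (exp (\<beta> * ln 4 / \<epsilon>) * exp (- \<beta> * h')) * (8 * min 1 (\<epsilon> * (r / 2) * exp (\<epsilon> * h')))))"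
      using M assms(1) r by (intro ennreal_leI mult_mono 1 2 order_refl) auto
    also have "\<dots> = ennreal (C * ?low)"
      using c by (simp add: C_def mult_ac)
    also have "\<dots> = ennreal C * ennreal ?low"
      using M c unfolding C_def by (intro ennreal_mult' mult_nonneg_nonneg divide_nonneg_pos) auto
    also have "\<dots> \<le> ennreal C * emeasure (tree_measure \<beta>) (tree_ball \<epsilon> (ray_point w s) (2 * (r / 2)))"
      using r by (intro mult_left_mono emeasure_ball_ge assms \<beta> w h') auto
    finally show ?thesis using w(3) by simp
  qed
  then show ?thesis by blast
qed

end

theorem corollary3p9:
  fixes V :: "'v set" and E :: "('v \<times> 'v) set" and root :: 'v
    and K :: nat and \<epsilon> \<beta> :: real
  assumes "K \<ge> 1" and "\<epsilon> > 0" and "\<beta> > ln (real K)"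
    and "rooted_tree V E root"
    and "\<forall>v\<in>V. finite (rooted_graph.children E root v) \<and>
           1 \<le> card (rooted_graph.children E root v) \<and>
           card (rooted_graph.children E root v) \<le> K"
  shows "\<exists>C::real. \<forall>x \<in> rooted_graph.points V E root. \<forall>r>0.
           emeasure (rooted_graph.tree_measure V E root \<beta>)
             (rooted_graph.tree_ball V E root \<epsilon> x (2 * r))
           \<le> ennreal C * emeasure (rooted_graph.tree_measure V E root \<beta>)
               (rooted_graph.tree_ball V E root \<epsilon> x r)"
proof -
  interpret rooted_tree V E root by fact
  interpret bounded_tree V E root K
    using assms(5) by unfold_locales auto
  show ?thesis using doubling assms(2,3) by blast
qed

end
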